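(* Given $x\in\mathbb{R}^n$, suppose that there exist $y\in\mathbb{R}^m$ and $p\in\mathbb{R}^s$ such that $(y,p)\in S(x)$ and the basic qualification holds at $y$ for $x$, i.e., $$u\in\partial^\infty h(G(x,y))\ \text{ and }\ \nabla_yG(x,y)^\top u=0\quad\Longrightarrow\quad u=0 .$$ Suppose also that the relative interior condition $G(x,y)\in\operatorname{ri}(\partial h^*(p))$ holds together with the second-order condition: for all $w\in\mathbb{R}^m$ and $z\in K_{h^*}(p,G(x,y))$, $$-\nabla_yG(x,y)^\top z=\nabla^2_{yy}L(x,y,p)w\ \text{ and }\ -\nabla_yG(x,y)w\in K_{h^*}(p,G(x,y))^\perp\quad\Longrightarrow\quad w=0,\ z=0 .$$ Then $S$ is single-valued and $C^1$ around $x$, with $S(x)=\{(y,p)\}$. Moreover, $$\nabla S(x)=-B(B^\top AB)^{-1}B^\top\begin{pmatrix}\nabla_x\nabla_yL(x,y,p)\\ \nabla_xG(x,y)\end{pmatrix},\qquad A=\begin{pmatrix}\nabla^2_{yy}L(x,y,p)&\nabla_yG(x,y)^\top\\ \nabla_yG(x,y)&0\end{pmatrix},$$ where $B$ is a matrix whose columns form a basis of $\mathbb{R}^m\times K_{h^*}(p,G(x,y))$.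
   Context: Standing assumptions: $g:\mathbb{R}^n\times\mathbb{R}^m\to\mathbb{R}$ and $G=(g_1,\dots,g_s):\mathbb{R}^n\times\mathbb{R}^m\to\mathbb{R}^s$ are $C^2$; for every $x\in\mathbb{R}^n$, $g(x,\cdot)$ and each $g_i(x,\cdot)$ are convex; $h:\mathbb{R}^s\to[-\infty,\infty]$ is proper, epi-polyhedral (its epigraph is a polyhedral set) and nondecreasing ($z\ge z'$ componentwise implies $h(z)\ge h(z')$). $h^*$ is the convex conjugate of $h$, $\partial h^*$ its subdifferential, and $\operatorname{ri}$ denotes relative interior. $S(x)$ is the set of $(y,p)\in\mathbb{R}^m\times\mathbb{R}^s$ with $$0=-\nabla_yg(x,y)-\nabla_yG(x,y)^\top p,\qquad 0\in-G(x,y)+\partial h^*(p).$$ The Lagrangian is $L(x,y,p)=g(x,y)+\langle G(x,y),p\rangle-h^*(p)$. The horizon subdifferential is $\partial^\infty h(z)=\{u\mid (u,0)\in N_{\operatorname{epi}h}(z,h(z))\}$ for $z$ with $h(z)$ finite, where $N$ denotes the normal cone. The critical cone of $h^*$ at $p$ for $u\in\partial h^*(p)$ is $K_{h^*}(p,u)=N_{\partial h^*(p)}(u)$ (a linear subspace when $u\in\operatorname{ri}\partial h^*(p)$). $\nabla_yG$ ($s\times m$), $\nabla_xG$ ($s\times n$), $\nabla_x\nabla_yL$ ($m\times n$) and $\nabla S$ ($(m+s)\times n$) are Jacobians. *)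

theory Defs
  imports "HOL-Analysis.Analysis"
begin

definition C1_on :: "'a::real_normed_vector set \<Rightarrow> ('a \<Rightarrow> 'b::real_normed_vector) \<Rightarrow> bool" where
  "C1_on U f \<longleftrightarrow>
     (\<exists>f' :: 'a \<Rightarrow> 'a \<Rightarrow>\<^sub>L 'b.
        (\<forall>x\<in>U. (f has_derivative blinfun_apply (f' x)) (at x)) \<and> continuous_on U f')"

definition C2_on :: "'a::real_normed_vector set \<Rightarrow> ('a \<Rightarrow> 'b::real_normed_vector) \<Rightarrow> bool" where
  "C2_on U f \<longleftrightarrow>
     (\<exists>f' :: 'a \<Rightarrow> 'a \<Rightarrow>\<^sub>L 'b.
        (\<forall>x\<in>U. (f has_derivative blinfun_apply (f' x)) (at x)) \<and> C1_on U f')"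

definition gradient :: "('a::real_inner \<Rightarrow> real) \<Rightarrow> 'a \<Rightarrow> 'a" where
  "gradient f x = (THE D. GDERIV f x :> D)"

definition grad_y :: "((real^'n) \<times> (real^'m) \<Rightarrow> real) \<Rightarrow> real^'n \<Rightarrow> real^'m \<Rightarrow> real^'m" where
  "grad_y g x y = gradient (\<lambda>y'. g (x, y')) y"

definition jac_y :: "((real^'n) \<times> (real^'m) \<Rightarrow> real^'s) \<Rightarrow> real^'n \<Rightarrow> real^'m \<Rightarrow> real^'m^'s" where
  "jac_y G x y = jacobian (\<lambda>y'. G (x, y')) (at y)"

definition jac_x :: "((real^'n) \<times> (real^'m) \<Rightarrow> real^'s) \<Rightarrow> real^'n \<Rightarrow> real^'m \<Rightarrow> real^'n^'s" where
  "jac_x G x y = jacobian (\<lambda>x'. G (x', y)) (at x)"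

definition proper :: "('a \<Rightarrow> ereal) \<Rightarrow> bool" where
  "proper f \<longleftrightarrow> (\<forall>z. f z \<noteq> - \<infinity>) \<and> (\<exists>z. f z \<noteq> \<infinity>)"

definition epi :: "('a \<Rightarrow> ereal) \<Rightarrow> ('a \<times> real) set" where
  "epi f = {(z, t). f z \<le> ereal t}"

definition epi_polyhedral :: "('a::euclidean_space \<Rightarrow> ereal) \<Rightarrow> bool" where
  "epi_polyhedral f \<longleftrightarrow> polyhedron (epi f)"

definition conjugate :: "('a::real_inner \<Rightarrow> ereal) \<Rightarrow> 'a \<Rightarrow> ereal" where
  "conjugate f p = (SUP z. ereal (p \<bullet> z) - f z)"

definition subdifferential :: "('a::real_inner \<Rightarrow> ereal) \<Rightarrow> 'a \<Rightarrow> 'a set" where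
  "subdifferential f p =
     {u. \<bar>f p\<bar> \<noteq> \<infinity> \<and> (\<forall>q. f p + ereal (u \<bullet> (q - p)) \<le> f q)}"

(* The normal cone of convex analysis: it is only ever taken of convex sets here
   (the epigraph of an epi-polyhedral function, the subdifferential of a conjugate). *)
definition normal_cone :: "'a::real_inner set \<Rightarrow> 'a \<Rightarrow> 'a set" where
  "normal_cone C u = {v. u \<in> C \<and> (\<forall>c\<in>C. v \<bullet> (c - u) \<le> 0)}"

definition horizon_subdifferential :: "('a::real_inner \<Rightarrow> ereal) \<Rightarrow> 'a \<Rightarrow> 'a set" where
  "horizon_subdifferential f z =
     {u. \<bar>f z\<bar> \<noteq> \<infinity> \<and> (u, 0) \<in> normal_cone (epi f) (z, real_of_ereal (f z))}"

definition critical_cone :: "('a::real_inner \<Rightarrow> ereal) \<Rightarrow> 'a \<Rightarrow> 'a \<Rightarrow> 'a set" where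
  "critical_cone f p u = normal_cone (subdifferential f p) u"

definition solution_map ::
  "((real^'n) \<times> (real^'m) \<Rightarrow> real) \<Rightarrow> ((real^'n) \<times> (real^'m) \<Rightarrow> real^'s) \<Rightarrow> (real^'s \<Rightarrow> ereal) \<Rightarrow>
   real^'n \<Rightarrow> ((real^'m) \<times> (real^'s)) set" where
  "solution_map g G h x =
     {(y, p). 0 = - grad_y g x y - transpose (jac_y G x y) *v p \<and>
              0 \<in> (\<lambda>u. - G (x, y) + u) ` subdifferential (conjugate h) p}"

definition lagrangian ::
  "((real^'n) \<times> (real^'m) \<Rightarrow> real) \<Rightarrow> ((real^'n) \<times> (real^'m) \<Rightarrow> real^'s) \<Rightarrow> (real^'s \<Rightarrow> ereal) \<Rightarrow>
   real^'n \<Rightarrow> real^'m \<Rightarrow> real^'s \<Rightarrow> ereal" where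
  "lagrangian g G h x y p = ereal (g (x, y) + G (x, y) \<bullet> p) - conjugate h p"

(* Derivatives of the Lagrangian in x and y are those of its real value; they are meaningful
   where the conjugate of h is finite at p, in particular where (y, p) solves the system at x. *)
definition lagrangian_grad_y ::
  "((real^'n) \<times> (real^'m) \<Rightarrow> real) \<Rightarrow> ((real^'n) \<times> (real^'m) \<Rightarrow> real^'s) \<Rightarrow> (real^'s \<Rightarrow> ereal) \<Rightarrow>
   real^'n \<Rightarrow> real^'m \<Rightarrow> real^'s \<Rightarrow> real^'m" where
  "lagrangian_grad_y g G h x y p = gradient (\<lambda>y'. real_of_ereal (lagrangian g G h x y' p)) y"

definition lagrangian_hess_yy ::
  "((real^'n) \<times> (real^'m) \<Rightarrow> real) \<Rightarrow> ((real^'n) \<times> (real^'m) \<Rightarrow> real^'s) \<Rightarrow> (real^'s \<Rightarrow> ereal) \<Rightarrow>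
   real^'n \<Rightarrow> real^'m \<Rightarrow> real^'s \<Rightarrow> real^'m^'m" where
  "lagrangian_hess_yy g G h x y p = jacobian (\<lambda>y'. lagrangian_grad_y g G h x y' p) (at y)"

definition lagrangian_jac_xy ::
  "((real^'n) \<times> (real^'m) \<Rightarrow> real) \<Rightarrow> ((real^'n) \<times> (real^'m) \<Rightarrow> real^'s) \<Rightarrow> (real^'s \<Rightarrow> ereal) \<Rightarrow>
   real^'n \<Rightarrow> real^'m \<Rightarrow> real^'s \<Rightarrow> real^'n^'m" where
  "lagrangian_jac_xy g G h x y p = jacobian (\<lambda>x'. lagrangian_grad_y g G h x' y p) (at x)"

(* Concatenation of two vectors. A matrix is the vector of its rows, so on matrices
   this puts the first one on top of the second. *)
definition vstack :: "'a^'m \<Rightarrow> 'a^'s \<Rightarrow> 'a^('m + 's)" where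
  "vstack a b = (\<chi> k. case k of Inl i \<Rightarrow> a $ i | Inr j \<Rightarrow> b $ j)"

definition hstack :: "'a^'m^'r \<Rightarrow> 'a^'s^'r \<Rightarrow> 'a^('m + 's)^'r" where
  "hstack M N = (\<chi> i. vstack (M $ i) (N $ i))"

definition kkt_matrix ::
  "((real^'n) \<times> (real^'m) \<Rightarrow> real) \<Rightarrow> ((real^'n) \<times> (real^'m) \<Rightarrow> real^'s) \<Rightarrow> (real^'s \<Rightarrow> ereal) \<Rightarrow>
   real^'n \<Rightarrow> real^'m \<Rightarrow> real^'s \<Rightarrow> real^('m + 's)^('m + 's)" where
  "kkt_matrix g G h x y p =
     vstack (hstack (lagrangian_hess_yy g G h x y p) (transpose (jac_y G x y)))
            (hstack (jac_y G x y) 0)"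

definition columns_form_basis :: "real^'k^'r \<Rightarrow> (real^'r) set \<Rightarrow> bool" where
  "columns_form_basis B V \<longleftrightarrow>
     inj (\<lambda>k. column k B) \<and> independent (columns B) \<and> span (columns B) = V"

end

theory Submission
  imports Defs
begin

text \<open>Near \<open>(p, G (x, y))\<close> the graph of the subdifferential of the polyhedral function
  \<open>h*\<close> is, under the relative interior condition, the affine space
  \<open>(p, G (x, y)) + K \<times> K\<^sup>\<bottom>\<close> with \<open>K\<close> the critical cone. With \<open>P\<close> the orthogonal projection onto
  \<open>K\<close>, the inclusion defining \<open>S x'\<close> is therefore locally the smooth equation
  \<open>\<nabla>\<^sub>yL (x', y', p') = 0\<close>, \<open>(I - P) (p' - p) - P (G (x', y') - G (x, y)) = 0\<close>, whose partial
  derivative in \<open>(y', p')\<close> is injective by the second-order condition, and the implicit function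
  theorem yields a locally unique \<open>C\<^sup>1\<close> solution. Globally \<open>S x'\<close> is the set of saddle points of a
  convex-concave function, hence convex, and a convex set with an isolated point is a
  singleton.\<close>

section \<open>Subgradients and conjugates\<close>

text \<open>Polyhedrality is given for \<open>epi h\<close>, not for the conjugate. Duality turns
  \<open>u' \<in> subdifferential (conjugate h) p'\<close> into the statement that the functional
  \<open>(p', -1)\<close> is maximal over \<open>epi h\<close> at \<open>(u', h u')\<close>, so the
  local study of the graph takes place on that one polyhedron, near \<open>(u, h u)\<close>.
  Separate equations for membership in K and in its orthogonal complement would be 2s conditions in
  place of s; as the two residuals lie in complementary subspaces, their difference vanishes only if
  both do, which leaves the square system that the implicit function theorem requires. Monotonicity
  of \<open>h\<close> puts the multipliers into the nonnegative orthant, where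
  \<open>G (x, y) \<bullet> p\<close> is convex in y; this makes the Lagrangian convex-concave. For
  the Jacobian, the derivative v of the solution in a direction \<xi> is characterised by: v lies in
  V and A v + M \<xi> is orthogonal to V, where V is the product of the y-space and K, and M stacks
  the derivatives in x. The substitution v = B c reduces this to an invertible system in c.\<close>

lemma conjugate_le_iff:
  assumes "proper h"
  shows "conjugate h p \<le> ereal c \<longleftrightarrow> (\<forall>(z, t)\<in>epi h. p \<bullet> z - t \<le> c)"
proof -
  have "ereal (p \<bullet> z) - h z \<le> ereal c \<longleftrightarrow> (\<forall>t. h z \<le> ereal t \<longrightarrow> p \<bullet> z - t \<le> c)" for z
  proof (cases "h z")
    case (real r)
    then show ?thesis by force
  next
    case MInf
    then show ?thesis using assms by (simp add: proper_def)
  qed auto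
  then show ?thesis
    by (auto simp: conjugate_def SUP_le_iff epi_def)
qed

lemma conjugate_upper: "ereal (p \<bullet> z) - h z \<le> conjugate h p"
  unfolding conjugate_def by (rule SUP_upper) simp

lemma conjugate_not_MInf:
  assumes "proper h"
  shows "conjugate h p \<noteq> - \<infinity>"
proof -
  obtain z r where "h z = ereal r"
    using assms by (metis proper_def ereal_cases)
  then show ?thesis
    using conjugate_upper[of p z h] by auto
qed

text \<open>Geometrically, \<open>(p, -1)\<close> supports \<open>epi h\<close> at
  \<open>(u, h u)\<close>. Quantifying over points of the epigraph keeps all inequalities
  real-valued although \<open>h\<close> may be infinite.\<close>

lemma subdifferential_iff_epi:
  assumes "proper h"
  shows "p \<in> subdifferential h u \<longleftrightarrow>
    (\<exists>r. h u = ereal r \<and> (\<forall>(z, t)\<in>epi h. r + p \<bullet> (z - u) \<le> t))"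
proof -
  have *: "ereal r + ereal (p \<bullet> (z - u)) \<le> h z \<longleftrightarrow> (\<forall>t. h z \<le> ereal t \<longrightarrow> r + p \<bullet> (z - u) \<le> t)" for r z
  proof (cases "h z")
    case (real r)
    then show ?thesis by force
  next
    case MInf
    then show ?thesis using assms by (simp add: proper_def)
  qed auto
  have "\<bar>h u\<bar> \<noteq> \<infinity> \<longleftrightarrow> (\<exists>r. h u = ereal r)"
    by (cases "h u") auto
  then show ?thesis
    unfolding subdifferential_def epi_def mem_Collect_eq
    by (auto simp del: plus_ereal.simps simp add: *)
qed

lemma conjugate_eq_of_subgradient:
  assumes "proper h" "p \<in> subdifferential h u" "h u = ereal r"
  shows "conjugate h p = ereal (p \<bullet> u - r)"
proof (rule antisym)
  have "r + p \<bullet> (z - u) \<le> t" if "(z, t) \<in> epi h" for z t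
    using subdifferential_iff_epi[OF assms(1)] assms(2,3) that by fastforce
  then show "conjugate h p \<le> ereal (p \<bullet> u - r)"
    unfolding conjugate_le_iff[OF assms(1)] by (fastforce simp: inner_diff_right)
  show "ereal (p \<bullet> u - r) \<le> conjugate h p"
    using conjugate_upper[of p u h] assms(3) by simp
qed

text \<open>A point outside the closed convex epigraph is strictly separated from it by a hyperplane
  with normal \<open>(a, \<beta>)\<close>; the subgradient inequality fails at a slope built from
  this normal. This is the part of biconjugation that duality needs.\<close>

lemma subgradient_of_conjugate_in_epi:
  fixes h :: "'a::euclidean_space \<Rightarrow> ereal"
  assumes h: "proper h" "convex (epi h)" "closed (epi h)"
    and c: "conjugate h p = ereal c"
    and u: "u \<in> subdifferential (conjugate h) p"
  shows "(u, u \<bullet> p - c) \<in> epi h"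
proof (rule ccontr)
  assume "(u, u \<bullet> p - c) \<notin> epi h"
  then obtain a \<beta> b where
      below: "a \<bullet> u + \<beta> * (u \<bullet> p - c) < b" and
      above: "\<And>z t. (z, t) \<in> epi h \<Longrightarrow> a \<bullet> z + \<beta> * t > b"
    using separating_hyperplane_closed_point[OF h(2,3), of "(u, u \<bullet> p - c)"]
    by (force simp: inner_prod_def)
  have sub: "ereal c + ereal (u \<bullet> (q - p)) \<le> conjugate h q" for q
    using u c by (simp add: subdifferential_def)
  obtain z0 t0 where z0: "h z0 = ereal t0"
    using h(1) by (metis proper_def ereal_cases)
  have "\<beta> \<ge> 0"
  proof (rule ccontr)
    assume "\<not> \<beta> \<ge> 0"
    \<comment> \<open>The epigraph is upward closed, so t may grow until the term with negative
      \<beta> brings the functional down to at most b.\<close>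
    define t where "t = max t0 ((b - a \<bullet> z0) / \<beta>)"
    have "(z0, t) \<in> epi h"
      by (simp add: epi_def z0 t_def)
    then have "b - a \<bullet> z0 < \<beta> * t"
      using above by force
    moreover have "\<beta> * t \<le> \<beta> * ((b - a \<bullet> z0) / \<beta>)"
      using \<open>\<not> \<beta> \<ge> 0\<close> by (intro mult_left_mono_neg) (auto simp: t_def)
    ultimately show False
      using \<open>\<not> \<beta> \<ge> 0\<close> by simp
  qed
  show False
  proof (cases "\<beta> = 0")
    case True
    \<comment> \<open>For a vertical hyperplane the conjugate drops by at least b from p to
      \<open>p - a\<close>, while the subgradient u allows a drop of at most
      \<open>a \<bullet> u\<close>, which is less than b.\<close>
    have "conjugate h (p - a) \<le> ereal (c - b)"
      unfolding conjugate_le_iff[OF h(1)]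
    proof clarify
      fix z t assume zt: "(z, t) \<in> epi h"
      then have "p \<bullet> z - t \<le> c"
        using conjugate_le_iff[OF h(1), of p c] c by auto
      then show "(p - a) \<bullet> z - t \<le> c - b"
        using above[OF zt] True by (simp add: inner_diff_left)
    qed
    then have "ereal c + ereal (u \<bullet> (p - a - p)) \<le> ereal (c - b)"
      using sub order_trans by blast
    then show False
      using below True by (simp add: inner_diff_right inner_commute)
  next
    case False
    then have \<beta>: "\<beta> > 0" using \<open>\<beta> \<ge> 0\<close> by simp
    \<comment> \<open>Division by \<beta> makes the hyperplane the graph of an affine minorant of
      \<open>h\<close> with slope q, which bounds the conjugate at q.\<close>
    define q where "q = (- 1 / \<beta>) *\<^sub>R a"
    have "conjugate h q \<le> ereal (- b / \<beta>)"
      unfolding conjugate_le_iff[OF h(1)]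
    proof clarify
      fix z t assume "(z, t) \<in> epi h"
      from above[OF this] show "q \<bullet> z - t \<le> - b / \<beta>"
        using mult_strict_left_mono[OF _ \<beta>, of b "a \<bullet> z + \<beta> * t"] \<beta>
        by (simp add: q_def field_simps)
    qed
    then have "ereal c + ereal (u \<bullet> (q - p)) \<le> ereal (- b / \<beta>)"
      using sub order_trans by blast
    then have "c + u \<bullet> (q - p) \<le> - b / \<beta>"
      by simp
    then have "\<beta> * (c + u \<bullet> (q - p)) \<le> - b"
      using \<beta> by (simp add: field_simps)
    moreover have "\<beta> * (c + u \<bullet> (q - p)) = \<beta> * c - a \<bullet> u - \<beta> * (u \<bullet> p)"
      using \<beta> by (simp add: q_def inner_diff_right inner_commute algebra_simps)
    ultimately show False
      using below by (simp add: algebra_simps)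
  qed
qed

text \<open>The inversion rule for subdifferentials. From left to right, the point
  \<open>(u, u \<bullet> p - c)\<close> of \<open>epi h\<close> forces equality in the Fenchel-Young
  inequality.\<close>

lemma subdifferential_conjugate_iff:
  fixes h :: "'a::euclidean_space \<Rightarrow> ereal"
  assumes h: "proper h" "convex (epi h)" "closed (epi h)"
  shows "u \<in> subdifferential (conjugate h) p \<longleftrightarrow> p \<in> subdifferential h u"
proof
  assume p: "p \<in> subdifferential h u"
  then obtain r where r: "h u = ereal r"
    using subdifferential_iff_epi[OF h(1)] by blast
  have "ereal (p \<bullet> u - r) + ereal (u \<bullet> (q - p)) \<le> conjugate h q" for q
    using conjugate_upper[of q u h] r by (simp add: inner_diff_right inner_commute)
  then show "u \<in> subdifferential (conjugate h) p"
    using conjugate_eq_of_subgradient[OF h(1) p r] by (simp add: subdifferential_def)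
next
  assume u: "u \<in> subdifferential (conjugate h) p"
  then obtain c where c: "conjugate h p = ereal c"
    by (cases "conjugate h p") (auto simp: subdifferential_def)
  have le: "p \<bullet> z - t \<le> c" if "(z, t) \<in> epi h" for z t
    using conjugate_le_iff[OF h(1), of p c] c that by auto
  have u_epi: "h u \<le> ereal (u \<bullet> p - c)"
    using subgradient_of_conjugate_in_epi[OF h c u] by (simp add: epi_def)
  then obtain r where r: "h u = ereal r"
    using h(1) by (cases "h u") (auto simp: proper_def)
  then have "r \<le> u \<bullet> p - c"
    using u_epi by simp
  then have "r + p \<bullet> (z - u) \<le> t" if "(z, t) \<in> epi h" for z t
    using le[OF that] by (simp add: inner_diff_right inner_commute)
  then show "p \<in> subdifferential h u"
    using subdifferential_iff_epi[OF h(1)] r by fast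
qed

section \<open>Graphs of polyhedral subdifferentials\<close>

text \<open>The finitely many constraints that are inactive at \<zeta> hold strictly there, hence on
  a ball. \<open>A\<close> consists of the active normals, so near \<zeta> the polyhedron is \<zeta>
  plus a cone.\<close>

lemma polyhedron_locally_conic:
  fixes P :: "'a::euclidean_space set"
  assumes "polyhedron P" "\<zeta> \<in> P"
  obtains A r where "r > 0"
    and "\<And>\<xi> a. \<xi> \<in> P \<Longrightarrow> a \<in> A \<Longrightarrow> a \<bullet> (\<xi> - \<zeta>) \<le> 0"
    and "\<And>\<xi>. dist \<xi> \<zeta> < r \<Longrightarrow> (\<And>a. a \<in> A \<Longrightarrow> a \<bullet> (\<xi> - \<zeta>) \<le> 0) \<Longrightarrow> \<xi> \<in> P"
proof -
  obtain F where F: "finite F" "P = \<Inter> F" "\<forall>H\<in>F. \<exists>a b. a \<noteq> 0 \<and> H = {x. a \<bullet> x \<le> b}"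
    using assms(1) unfolding polyhedron_def by blast
  then obtain a b where "\<And>H. H \<in> F \<Longrightarrow> H = {x. a H \<bullet> x \<le> b H}"
    by metis
  then have ab: "\<And>H x. H \<in> F \<Longrightarrow> x \<in> H \<longleftrightarrow> a H \<bullet> x \<le> b H"
    by blast
  define I where "I = {H\<in>F. a H \<bullet> \<zeta> = b H}"
  have "\<forall>\<^sub>F \<xi> in nhds \<zeta>. \<forall>H\<in>F - I. a H \<bullet> \<xi> < b H"
  proof (rule eventually_ball_finite)
    show "finite (F - I)" using F by simp
    show "\<forall>H\<in>F - I. \<forall>\<^sub>F \<xi> in nhds \<zeta>. a H \<bullet> \<xi> < b H"
    proof
      fix H assume H: "H \<in> F - I"
      then have "a H \<bullet> \<zeta> < b H"
        using assms(2) F(2) ab[of H \<zeta>] by (auto simp: I_def)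
      moreover have "((\<lambda>\<xi>. a H \<bullet> \<xi>) \<longlongrightarrow> a H \<bullet> \<zeta>) (nhds \<zeta>)"
        by (intro tendsto_intros filterlim_ident)
      ultimately show "\<forall>\<^sub>F \<xi> in nhds \<zeta>. a H \<bullet> \<xi> < b H"
        using order_tendstoD(2) by blast
    qed
  qed
  then obtain r where r: "r > 0" "\<And>\<xi> H. dist \<xi> \<zeta> < r \<Longrightarrow> H \<in> F - I \<Longrightarrow> a H \<bullet> \<xi> < b H"
    unfolding eventually_nhds_metric by blast
  show thesis
  proof (rule that[of r "a ` I"])
    show "c \<bullet> (\<xi> - \<zeta>) \<le> 0" if "\<xi> \<in> P" "c \<in> a ` I" for \<xi> c
      using that F(2) ab by (auto simp: I_def inner_diff_right)
    show "\<xi> \<in> P" if \<xi>: "dist \<xi> \<zeta> < r" "\<And>c. c \<in> a ` I \<Longrightarrow> c \<bullet> (\<xi> - \<zeta>) \<le> 0" for \<xi>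
      unfolding F(2)
    proof
      fix H assume H: "H \<in> F"
      have "a H \<bullet> \<xi> \<le> b H"
      proof (cases "H \<in> I")
        case True
        then show ?thesis
          using \<xi>(2)[of "a H"] by (simp add: I_def inner_diff_right)
      next
        case False
        then show ?thesis
          using r(2)[OF \<xi>(1), of H] H by simp
      qed
      then show "\<xi> \<in> H" using ab[OF H] by simp
    qed
  qed (use r in simp)
qed

text \<open>Hypothesis \<open>rev\<close> says that \<open>\<zeta>\<close> lies in the relative interior of the face exposed by \<open>c\<close>.
  Modulo the linear span of that face, \<open>c\<close> is uniformly negative on the directions pointing into
  \<open>P\<close>, by compactness of the unit sphere.\<close>

lemma polyhedron_perturb_exposing_functional:
  fixes P :: "'a::euclidean_space set"
  assumes P: "polyhedron P" "\<zeta> \<in> P"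
    and max: "\<And>\<xi>. \<xi> \<in> P \<Longrightarrow> c \<bullet> (\<xi> - \<zeta>) \<le> 0"
    and rev: "\<And>\<xi>. \<xi> \<in> P \<Longrightarrow> c \<bullet> (\<xi> - \<zeta>) = 0 \<Longrightarrow> \<exists>s>0. \<zeta> + s *\<^sub>R (\<zeta> - \<xi>) \<in> P"
  obtains \<epsilon> where "\<epsilon> > 0"
    and "\<And>q \<xi>. norm q \<le> \<epsilon> \<Longrightarrow> (\<And>\<eta>. \<eta> \<in> P \<Longrightarrow> c \<bullet> (\<eta> - \<zeta>) = 0 \<Longrightarrow> q \<bullet> (\<eta> - \<zeta>) = 0) \<Longrightarrow>
           \<xi> \<in> P \<Longrightarrow> (c + q) \<bullet> (\<xi> - \<zeta>) \<le> 0"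
proof -
  obtain A r where r: "r > 0"
    and A1: "\<And>\<xi> a. \<xi> \<in> P \<Longrightarrow> a \<in> A \<Longrightarrow> a \<bullet> (\<xi> - \<zeta>) \<le> 0"
    and A2: "\<And>\<xi>. dist \<xi> \<zeta> < r \<Longrightarrow> (\<And>a. a \<in> A \<Longrightarrow> a \<bullet> (\<xi> - \<zeta>) \<le> 0) \<Longrightarrow> \<xi> \<in> P"
    using polyhedron_locally_conic[OF P] by metis
  \<comment> \<open>\<open>T\<close> is the tangent cone at \<zeta>, \<open>D\<close> the set of
    directions of the exposed face, and \<open>N\<close> the orthogonal complement of its
    span.\<close>
  define T where "T = {d. \<forall>a\<in>A. a \<bullet> d \<le> 0}"
  define D where "D = {\<xi> - \<zeta> | \<xi>. \<xi> \<in> P \<and> c \<bullet> (\<xi> - \<zeta>) = 0}"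
  define N where "N = {d. \<forall>l\<in>D. l \<bullet> d = 0}"
  have span_zero: "q \<bullet> l = 0" if "l \<in> span D" "\<And>d. d \<in> D \<Longrightarrow> q \<bullet> d = 0" for q l
    using that by (induction rule: span_induct_alt) (auto simp: inner_right_distrib)
  have step: "\<exists>s>0. \<zeta> + s *\<^sub>R d \<in> P" if "d \<in> T" for d
  proof -
    define s where "s = r / (2 * (norm d + 1))"
    have s: "s > 0" using r by (simp add: s_def add_nonneg_pos)
    have "norm d / (2 * (norm d + 1)) < 1"
      by (simp add: divide_simps add_nonneg_pos)
    then have "r * (norm d / (2 * (norm d + 1))) < r * 1"
      using r by (intro mult_strict_left_mono) auto
    then have "dist (\<zeta> + s *\<^sub>R d) \<zeta> < r"
      using r by (simp add: dist_norm s_def)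
    moreover have "a \<bullet> (\<zeta> + s *\<^sub>R d - \<zeta>) \<le> 0" if "a \<in> A" for a
      using \<open>d \<in> T\<close> that s by (auto simp: T_def mult_nonneg_nonpos)
    ultimately show ?thesis using A2 s by blast
  qed
  \<comment> \<open>Hypothesis \<open>rev\<close> puts the direction opposite to l into the tangent
    cone as well, so active normals vanish on \<open>D\<close>.\<close>
  have D_lineal: "a \<bullet> l = 0" if aA: "a \<in> A" and lD: "l \<in> D" for a l
  proof -
    obtain \<xi> where \<xi>: "\<xi> \<in> P" "c \<bullet> (\<xi> - \<zeta>) = 0" "l = \<xi> - \<zeta>"
      using lD D_def by blast
    then obtain s where "s > 0" "\<zeta> + s *\<^sub>R (\<zeta> - \<xi>) \<in> P"
      using rev by blast
    then have "s * (a \<bullet> (\<zeta> - \<xi>)) \<le> 0"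
      using A1[OF _ aA, of "\<zeta> + s *\<^sub>R (\<zeta> - \<xi>)"] by simp
    then have "a \<bullet> (\<zeta> - \<xi>) \<le> 0"
      using \<open>s > 0\<close> by (simp add: mult_le_0_iff)
    moreover have "a \<bullet> (\<xi> - \<zeta>) \<le> 0"
      using A1 \<xi> aA by blast
    ultimately show ?thesis
      using \<xi>(3) by (simp add: inner_diff_right)
  qed
  \<comment> \<open>A direction in \<open>T\<close> and \<open>N\<close> with
    \<open>c \<bullet> d = 0\<close> would, up to scaling, be a direction of the face, hence
    orthogonal to itself.\<close>
  have c_neg: "c \<bullet> d < 0" if d: "d \<in> T" "d \<in> N" "norm d = 1" for d
  proof -
    obtain s where s: "s > 0" "\<zeta> + s *\<^sub>R d \<in> P"
      using step d by blast
    have le: "s * (c \<bullet> d) \<le> 0"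
      using max[OF s(2)] by simp
    moreover have "c \<bullet> d \<noteq> 0"
    proof
      assume "c \<bullet> d = 0"
      then have "s *\<^sub>R d \<in> D"
        using s(2) unfolding D_def mem_Collect_eq
        by (intro exI[of _ "\<zeta> + s *\<^sub>R d"]) simp
      then have "(s *\<^sub>R d) \<bullet> d = 0"
        using d(2) unfolding N_def by blast
      then show False using s(1) d(3) by auto
    qed
    ultimately show ?thesis
      using s(1) mult_pos_pos[of s "c \<bullet> d"] by linarith
  qed
  obtain \<epsilon> where \<epsilon>: "\<epsilon> > 0" "\<And>d. d \<in> T \<Longrightarrow> d \<in> N \<Longrightarrow> norm d = 1 \<Longrightarrow> c \<bullet> d \<le> - \<epsilon>"
  proof (cases "T \<inter> N \<inter> sphere 0 1 = {}")
    case True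
    then show thesis by (intro that[of 1]) auto
  next
    case False
    have "T = (\<Inter>a\<in>A. {d. a \<bullet> d \<le> 0})" "N = (\<Inter>l\<in>D. {d. l \<bullet> d = 0})"
      by (auto simp: T_def N_def)
    then have "closed T" "closed N"
      by (simp_all add: closed_INT closed_halfspace_le closed_hyperplane)
    then have "compact (T \<inter> N \<inter> sphere 0 1)"
      by (intro closed_Int_compact closed_Int) auto
    moreover have "continuous_on (T \<inter> N \<inter> sphere 0 1) (\<lambda>d. c \<bullet> d)"
      by (intro continuous_intros)
    ultimately obtain d0 where d0: "d0 \<in> T \<inter> N \<inter> sphere 0 1"
        "\<And>d. d \<in> T \<inter> N \<inter> sphere 0 1 \<Longrightarrow> c \<bullet> d \<le> c \<bullet> d0"
      using continuous_attains_sup[OF _ False] by blast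
    show thesis
    proof (rule that[of "- (c \<bullet> d0)"])
      show "- (c \<bullet> d0) > 0" using c_neg d0(1) by simp
    qed (use d0(2) in auto)
  qed
  show thesis
  proof (rule that[OF \<epsilon>(1)])
    fix q \<xi>
    assume q: "norm q \<le> \<epsilon>" "\<And>\<eta>. \<eta> \<in> P \<Longrightarrow> c \<bullet> (\<eta> - \<zeta>) = 0 \<Longrightarrow> q \<bullet> (\<eta> - \<zeta>) = 0"
      and \<xi>: "\<xi> \<in> P"
    \<comment> \<open>On the component l along the face, c, q and all active normals vanish; the
      orthogonal component d therefore stays in \<open>T\<close>, where the negativity of c
      outweighs q.\<close>
    obtain l d where l: "l \<in> span D" and d: "\<And>w. w \<in> span D \<Longrightarrow> orthogonal d w"
      and ld: "\<xi> - \<zeta> = l + d"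
      using orthogonal_subspace_decomp_exists by blast
    have cl: "c \<bullet> l = 0"
      by (rule span_zero[OF l]) (auto simp: D_def)
    have ql: "q \<bullet> l = 0"
      by (rule span_zero[OF l]) (use q(2) in \<open>auto simp: D_def\<close>)
    have "a \<bullet> l = 0" if "a \<in> A" for a
      by (rule span_zero[OF l]) (use D_lineal that in blast)
    moreover have "d = \<xi> - \<zeta> - l" using ld by simp
    ultimately have dT: "d \<in> T"
      using A1[OF \<xi>] by (simp add: T_def inner_diff_right)
    have dN: "d \<in> N"
      using d unfolding N_def orthogonal_def by (auto simp: inner_commute span_base)
    have "c \<bullet> d \<le> - \<epsilon> * norm d"
    proof (cases "d = 0")
      case False
      have "(1 / norm d) *\<^sub>R d \<in> T" "(1 / norm d) *\<^sub>R d \<in> N"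
        using dT dN by (auto simp: T_def N_def divide_simps mult_le_0_iff)
      from \<epsilon>(2)[OF this] False show ?thesis
        by (simp add: field_simps)
    qed simp
    moreover have "q \<bullet> d \<le> \<epsilon> * norm d"
      using norm_cauchy_schwarz[of q d] mult_right_mono[OF q(1), of "norm d"] by simp
    ultimately show "(c + q) \<bullet> (\<xi> - \<zeta>) \<le> 0"
      unfolding ld by (simp add: inner_add_left inner_add_right cl ql)
  qed
qed

section \<open>Relative interiors, normal cones and the local form of the graph\<close>

lemma rel_interior_reverse_step:
  fixes C :: "'a::euclidean_space set"
  assumes "u \<in> rel_interior C" "z \<in> C"
  obtains s where "s > 0" "u + s *\<^sub>R (u - z) \<in> C"
proof -
  obtain e where e: "e > 0" "cball u e \<inter> affine hull C \<subseteq> C" and u: "u \<in> C"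
    using assms(1) unfolding mem_rel_interior_cball by blast
  define s where "s = e / (norm (u - z) + 1)"
  have s: "s > 0" using e by (simp add: s_def add_nonneg_pos)
  have "norm (u - z) / (norm (u - z) + 1) \<le> 1"
    by (simp add: divide_simps add_nonneg_pos)
  then have "e * (norm (u - z) / (norm (u - z) + 1)) \<le> e * 1"
    using e by (intro mult_left_mono) auto
  then have "u + s *\<^sub>R (u - z) \<in> cball u e"
    using e by (simp add: dist_norm s_def)
  moreover have "(1 + s) *\<^sub>R u + (- s) *\<^sub>R z \<in> affine hull C"
    using u assms(2) by (intro mem_affine[OF affine_affine_hull]) (auto intro: hull_inc)
  then have "u + s *\<^sub>R (u - z) \<in> affine hull C"
    by (simp add: algebra_simps)
  ultimately show thesis
    using that[OF s] e(2) by blast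
qed

text \<open>At a relative interior point every direction \<open>z - u\<close> can be reversed inside
  \<open>C\<close>, so the inequality defining the normal cone holds with both signs.\<close>

lemma normal_cone_rel_interior:
  fixes C :: "'a::euclidean_space set"
  assumes "u \<in> rel_interior C"
  shows "normal_cone C u = {v. \<forall>z\<in>C. v \<bullet> (z - u) = 0}"
proof -
  have "v \<bullet> (z - u) = 0" if v: "v \<in> normal_cone C u" and z: "z \<in> C" for v z
  proof -
    obtain s where s: "s > 0" "u + s *\<^sub>R (u - z) \<in> C"
      using rel_interior_reverse_step[OF assms z] .
    have "v \<bullet> (s *\<^sub>R (u - z)) \<le> 0"
      using v s(2) unfolding normal_cone_def by fastforce
    then have "v \<bullet> (u - z) \<le> 0"
      using s(1) by (simp add: mult_le_0_iff)
    moreover have "v \<bullet> (z - u) \<le> 0"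
      using v z by (simp add: normal_cone_def)
    ultimately show ?thesis by (simp add: inner_diff_right)
  qed
  then show ?thesis
    using assms rel_interior_subset[of C] by (auto simp: normal_cone_def)
qed

lemma orthogonal_comp_span: "orthogonal_comp (span S) = {v. \<forall>w\<in>S. w \<bullet> v = 0}"
proof -
  have "w \<bullet> v = 0" if "w \<in> span S" "\<forall>w\<in>S. w \<bullet> v = 0" for w v
    using that by (induction rule: span_induct_alt) (auto simp: inner_left_distrib)
  then show ?thesis
    by (auto simp: orthogonal_comp_def orthogonal_def span_base)
qed

text \<open>This is why the critical cone is a subspace; its orthogonal complement is the subspace
  parallel to the affine hull of \<open>C\<close>.\<close>

lemma normal_cone_rel_interior_eq_orthogonal_comp:
  fixes C :: "'a::euclidean_space set"
  assumes "u \<in> rel_interior C"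
  shows "normal_cone C u = orthogonal_comp (span ((\<lambda>z. z - u) ` C))"
  by (auto simp: normal_cone_rel_interior[OF assms] orthogonal_comp_span inner_commute)

text \<open>The subgradients of the conjugate at p form the projection of the face of
  \<open>epi h\<close> exposed by \<open>(p, -1)\<close>. Sufficiency: a small move of p within
  \<open>K\<close> keeps u a maximiser, a small move of u along the complement stays in that
  projection, and the two moves are orthogonal. Necessity: \<open>epi h\<close> is conic near
  \<open>(u, h u)\<close>, so a segment from there to \<open>(u', h u')\<close> can be prolonged,
  which forces equality in the supporting inequalities.\<close>

lemma polyhedral_subdifferential_graph_locally_affine:
  fixes h :: "'a::euclidean_space \<Rightarrow> ereal"
  assumes h: "proper h" "epi_polyhedral h"
    and ri: "u \<in> rel_interior (subdifferential (conjugate h) p)"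
  defines "K \<equiv> critical_cone (conjugate h) p u"
  obtains \<delta> where "\<delta> > 0"
    and "\<And>p' u'. dist p' p < \<delta> \<Longrightarrow> dist u' u < \<delta> \<Longrightarrow>
           u' \<in> subdifferential (conjugate h) p' \<longleftrightarrow> p' - p \<in> K \<and> u' - u \<in> orthogonal_comp K"
proof -
  have P: "polyhedron (epi h)"
    using h(2) by (simp add: epi_polyhedral_def)
  note sub_iff = subdifferential_conjugate_iff[OF h(1) polyhedron_imp_convex[OF P] polyhedron_imp_closed[OF P]]
  note epi_iff = subdifferential_iff_epi[OF h(1)]
  define C where "C = subdifferential (conjugate h) p"
  have uC: "u \<in> C" using ri rel_interior_subset unfolding C_def by blast
  have C_iff: "z \<in> C \<longleftrightarrow> p \<in> subdifferential h z" for z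
    by (simp add: C_def sub_iff)
  obtain r where r: "h u = ereal r" and p_sub: "\<And>z t. (z, t) \<in> epi h \<Longrightarrow> r + p \<bullet> (z - u) \<le> t"
    using uC epi_iff unfolding C_iff by fast
  have u_epi: "(u, r) \<in> epi h" using r by (simp add: epi_def)
  \<comment> \<open>The subgradient inequalities with slope p at u and at z give opposite bounds, so
    \<open>h\<close> is affine on \<open>C\<close>.\<close>
  have h_C: "h z = ereal (r + p \<bullet> (z - u))" if zC: "z \<in> C" for z
  proof -
    obtain t where t: "h z = ereal t" "t + p \<bullet> (u - z) \<le> r"
      using zC epi_iff u_epi unfolding C_iff by fast
    moreover have "r + p \<bullet> (z - u) \<le> t"
      using p_sub[of z t] t by (simp add: epi_def)
    ultimately show ?thesis by (simp add: inner_diff_right)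
  qed
  have C_intro: "z \<in> C" if "(z, r + p \<bullet> (z - u)) \<in> epi h" for z
  proof -
    have hz: "h z \<le> ereal (r + p \<bullet> (z - u))"
      using that by (simp add: epi_def)
    then obtain t where t: "h z = ereal t"
      using h(1) by (cases "h z") (auto simp: proper_def)
    then have "t = r + p \<bullet> (z - u)"
      using hz p_sub[of z t] by (simp add: epi_def)
    then have "t + p \<bullet> (z' - z) \<le> t'" if "(z', t') \<in> epi h" for z' t'
      using p_sub[OF that] by (simp add: inner_diff_right)
    then show ?thesis
      using t epi_iff unfolding C_iff by fast
  qed
  have K_eq: "K = {v. \<forall>z\<in>C. v \<bullet> (z - u) = 0}"
    using normal_cone_rel_interior[OF ri] by (simp add: K_def critical_cone_def C_def)
  have K_comp: "orthogonal_comp K = span ((\<lambda>z. z - u) ` C)"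
    using normal_cone_rel_interior_eq_orthogonal_comp[OF ri]
    by (simp add: K_def critical_cone_def C_def orthogonal_comp_self)
  obtain e where e: "e > 0" "ball u e \<inter> affine hull C \<subseteq> C"
    using ri unfolding mem_rel_interior_ball C_def by blast
  \<comment> \<open>The affine hull of \<open>C\<close> is u plus the complement of
    \<open>K\<close>, and u is interior to \<open>C\<close> relative to it.\<close>
  have C_near: "u' \<in> C" if "u' - u \<in> orthogonal_comp K" "dist u' u < e" for u'
  proof -
    have "affine hull C = (\<lambda>v. u + v) ` span ((\<lambda>z. - u + z) ` C)"
      by (rule affine_hull_span_gen) (rule hull_inc[OF uC])
    then have "u' \<in> affine hull C"
      using that(1) unfolding K_comp by (auto simp: image_iff intro: bexI[of _ "u' - u"])
    then show ?thesis using e(2) that(2) by (auto simp: dist_commute)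
  qed
  obtain A \<rho> where \<rho>: "\<rho> > 0"
    and A1: "\<And>\<xi> a. \<xi> \<in> epi h \<Longrightarrow> a \<in> A \<Longrightarrow> a \<bullet> (\<xi> - (u, r)) \<le> 0"
    and A2: "\<And>\<xi>. dist \<xi> (u, r) < \<rho> \<Longrightarrow> (\<And>a. a \<in> A \<Longrightarrow> a \<bullet> (\<xi> - (u, r)) \<le> 0) \<Longrightarrow> \<xi> \<in> epi h"
    using polyhedron_locally_conic[OF P u_epi] by metis
  have doubling: "(2 *\<^sub>R \<xi> - (u, r)) \<in> epi h" if \<xi>: "\<xi> \<in> epi h" "2 * dist \<xi> (u, r) < \<rho>" for \<xi>
  proof (rule A2)
    have "2 *\<^sub>R \<xi> - (u, r) - (u, r) = 2 *\<^sub>R (\<xi> - (u, r))"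
      by (simp add: scaleR_2 algebra_simps)
    then show "dist (2 *\<^sub>R \<xi> - (u, r)) (u, r) < \<rho>"
      and "\<And>a. a \<in> A \<Longrightarrow> a \<bullet> (2 *\<^sub>R \<xi> - (u, r) - (u, r)) \<le> 0"
      using \<xi>(2) A1[OF \<xi>(1)] by (simp_all add: dist_norm)
  qed
  obtain \<epsilon> where \<epsilon>: "\<epsilon> > 0"
    and pert: "\<And>q \<xi>. norm q \<le> \<epsilon> \<Longrightarrow>
      (\<And>\<eta>. \<eta> \<in> epi h \<Longrightarrow> (p, -1) \<bullet> (\<eta> - (u, r)) = 0 \<Longrightarrow> q \<bullet> (\<eta> - (u, r)) = 0) \<Longrightarrow>
      \<xi> \<in> epi h \<Longrightarrow> ((p, -1) + q) \<bullet> (\<xi> - (u, r)) \<le> 0"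
  proof (rule polyhedron_perturb_exposing_functional[OF P u_epi, of "(p, -1)"])
    fix \<xi> assume \<xi>: "\<xi> \<in> epi h"
    obtain z t where zt: "\<xi> = (z, t)" by fastforce
    show "(p, -1) \<bullet> (\<xi> - (u, r)) \<le> 0"
      using p_sub[of z t] \<xi> by (simp add: zt)
    assume "(p, -1) \<bullet> (\<xi> - (u, r)) = 0"
    then have t: "t = r + p \<bullet> (z - u)" by (simp add: zt)
    then have "z \<in> C" using C_intro \<xi> zt by simp
    \<comment> \<open>The reversal inside \<open>C\<close> lifts to the exposed face of
      \<open>epi h\<close> because \<open>h\<close> is affine on \<open>C\<close>.\<close>
    then obtain s where s: "s > 0" "u + s *\<^sub>R (u - z) \<in> C"
      using rel_interior_reverse_step ri C_def by metis
    have "(u, r) + s *\<^sub>R ((u, r) - \<xi>) \<in> epi h"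
      using h_C[OF s(2)] by (simp add: epi_def zt t inner_diff_right algebra_simps)
    then show "\<exists>s>0. (u, r) + s *\<^sub>R ((u, r) - \<xi>) \<in> epi h"
      using s by blast
  qed blast
  have pert': "r + (p + q) \<bullet> (z - u) \<le> t" if q: "q \<in> K" "norm q \<le> \<epsilon>" and zt: "(z, t) \<in> epi h" for q z t
  proof -
    have "((p, -1) + (q, 0)) \<bullet> ((z, t) - (u, r)) \<le> 0"
    proof (rule pert)
      show "norm (q, 0::real) \<le> \<epsilon>" using q by (simp add: norm_Pair)
      fix \<eta> assume \<eta>: "\<eta> \<in> epi h" "(p, -1) \<bullet> (\<eta> - (u, r)) = 0"
      then have "fst \<eta> \<in> C"
        by (cases \<eta>) (auto intro!: C_intro simp: algebra_simps)
      then show "(q, 0::real) \<bullet> (\<eta> - (u, r)) = 0"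
        using q(1) by (cases \<eta>) (auto simp: K_eq)
    qed (rule zt)
    then show ?thesis by simp
  qed
  \<comment> \<open>M bounds the norms of p and of every p' within distance 1. In \<delta>, the
    bound \<open>\<epsilon> / 2\<close> admits the perturbation \<open>2 *\<^sub>R q\<close>, the
    bound e serves \<open>C_near\<close>, and the last one keeps twice the distance from
    \<open>(u', r')\<close> to \<open>(u, r)\<close> below \<rho>, as \<open>doubling\<close>
    demands.\<close>
  define M where "M = norm p + 2"
  define \<delta> where "\<delta> = min (min 1 (\<epsilon> / 2)) (min e (\<rho> / (2 * M + 2)))"
  have M: "M > 0" by (simp add: M_def add_nonneg_pos)
  have "\<rho> / (2 * M + 2) > 0" using \<rho> M by simp
  then have \<delta>: "\<delta> > 0" "\<delta> \<le> 1" "\<delta> \<le> \<epsilon> / 2" "\<delta> \<le> e" "\<delta> \<le> \<rho> / (2 * M + 2)"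
    using \<epsilon> e(1) unfolding \<delta>_def by linarith+
  show thesis
  proof (rule that[OF \<delta>(1)])
    fix p' u' assume p': "dist p' p < \<delta>" and u': "dist u' u < \<delta>"
    define q where "q = p' - p"
    define d where "d = u' - u"
    have norms: "norm q < \<delta>" "norm d < \<delta>"
      using p' u' by (auto simp: q_def d_def dist_norm)
    have u'_eq: "u' = u + d" and p'_eq: "p' = p + q" by (auto simp: q_def d_def)
    show "u' \<in> subdifferential (conjugate h) p' \<longleftrightarrow> p' - p \<in> K \<and> u' - u \<in> orthogonal_comp K"
    proof
      assume "u' \<in> subdifferential (conjugate h) p'"
      then obtain r' where r': "h u' = ereal r'"
        and p'_sub: "\<And>z t. (z, t) \<in> epi h \<Longrightarrow> r' + p' \<bullet> (z - u') \<le> t"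
        unfolding sub_iff epi_iff by fast
      have u'_epi: "(u', r') \<in> epi h" using r' by (simp add: epi_def)
      \<comment> \<open>The subgradient inequalities at the two points confine \<open>r' - r\<close>
        between \<open>p \<bullet> d\<close> and \<open>p' \<bullet> d\<close>.\<close>
      have le1: "r' - r \<le> p' \<bullet> d"
        using p'_sub[OF u_epi] by (simp add: u'_eq inner_diff_right)
      have le2: "p \<bullet> d \<le> r' - r"
        using p_sub[OF u'_epi] by (simp add: d_def)
      have "norm p' \<le> M" "norm p \<le> M"
        using norms(1) \<delta>(2) norm_triangle_ineq[of p q] by (auto simp: p'_eq M_def)
      then have "\<bar>p' \<bullet> d\<bar> \<le> M * norm d" "\<bar>p \<bullet> d\<bar> \<le> M * norm d"
        using Cauchy_Schwarz_ineq2[of p' d] Cauchy_Schwarz_ineq2[of p d]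
        by (meson mult_right_mono norm_ge_zero order_trans)+
      then have "\<bar>r' - r\<bar> \<le> M * norm d" using le1 le2 by linarith
      moreover have "dist (u', r') (u, r) \<le> norm d + \<bar>r' - r\<bar>"
        using norm_Pair_le[of d "r' - r"] by (simp add: dist_norm d_def)
      ultimately have "2 * dist (u', r') (u, r) \<le> (2 * M + 2) * norm d"
        by (simp add: algebra_simps)
      also have "\<dots> < (2 * M + 2) * \<delta>"
        using norms M by simp
      also have "\<dots> \<le> \<rho>"
        using \<delta>(5) M by (simp add: field_simps)
      (* The supporting functional (p', -1) is maximal at the midpoint u' of u and 2 u' - u,
         hence at both ends. *)
      finally have "(2 *\<^sub>R u' - u, 2 * r' - r) \<in> epi h"
        using doubling[OF u'_epi] by simp
      from p'_sub[OF this] have eq: "r' - r = p' \<bullet> d"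
        using le1 by (simp add: u'_eq scaleR_2 inner_add_right inner_diff_right)
      \<comment> \<open>By this equality p' also supports \<open>epi h\<close> at
        \<open>(u, r)\<close>; comparison with slope p on the graph over \<open>C\<close> leaves
        only q.\<close>
      have "q \<bullet> (z - u) \<le> 0" if "z \<in> C" for z
        using p'_sub[of z "r + p \<bullet> (z - u)"] h_C[OF that] eq
        by (simp add: epi_def p'_eq u'_eq inner_add_left inner_diff_right inner_add_right)
      then have qK: "q \<in> K"
        unfolding K_def critical_cone_def normal_cone_def using uC C_def by blast
      (* As p' is the midpoint of p and p + 2 q, a subgradient p + 2 q at u turns equality along p'
         into equality along p. *)
      have "2 *\<^sub>R q \<in> K" using qK by (simp add: K_eq)
      then have "r + (p + 2 *\<^sub>R q) \<bullet> (u' - u) \<le> r'"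
        using pert'[OF _ _ u'_epi] norms(1) \<delta>(3) by simp
      then have "r' = r + p \<bullet> (u' - u)"
        using eq le2 by (simp add: p'_eq d_def inner_add_left)
      then have "u' \<in> C"
        using C_intro u'_epi by simp
      then have "u' - u \<in> orthogonal_comp K"
        unfolding K_comp by (simp add: span_base)
      then show "p' - p \<in> K \<and> u' - u \<in> orthogonal_comp K"
        using qK q_def by simp
    next
      assume *: "p' - p \<in> K \<and> u' - u \<in> orthogonal_comp K"
      have "u' \<in> C"
        using C_near * u' \<delta>(4) by simp
      then have hu': "h u' = ereal (r + p \<bullet> d)"
        using h_C by (simp add: d_def)
      \<comment> \<open>Orthogonality makes the affine function of slope p' through
        \<open>(u, r)\<close> pass through \<open>(u', h u')\<close> too, so it supports
        \<open>epi h\<close> there.\<close>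
      have "q \<bullet> d = 0"
        using * by (simp add: q_def d_def orthogonal_comp_def orthogonal_def)
      moreover have "r + (p + q) \<bullet> (z - u) \<le> t" if "(z, t) \<in> epi h" for z t
        using pert'[OF _ _ that, of q] * norms(1) \<delta>(1,3) by (simp add: q_def)
      ultimately have "r + p \<bullet> d + p' \<bullet> (z - u') \<le> t" if "(z, t) \<in> epi h" for z t
        using that by (force simp: p'_eq u'_eq inner_add_left inner_diff_right inner_add_right)
      then show "u' \<in> subdifferential (conjugate h) p'"
        unfolding sub_iff epi_iff using hu' by fast
    qed
  qed
qed

section \<open>Continuously differentiable maps and implicit functions\<close>

lemma C1_on_continuous_on: "C1_on U f \<Longrightarrow> continuous_on U f"
  unfolding C1_on_def
  by (metis continuous_at_imp_continuous_on has_derivative_continuous)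

lemma C2_on_imp_C1_on: "C2_on U f \<Longrightarrow> C1_on U f"
  unfolding C2_on_def using C1_on_continuous_on by (auto simp: C1_on_def)

lemma C1_on_const: "C1_on U (\<lambda>x. c)"
  unfolding C1_on_def by (intro exI[of _ "\<lambda>x. 0"]) (auto simp: zero_blinfun.rep_eq)

lemma C1_on_add:
  assumes "C1_on U f" "C1_on U g"
  shows "C1_on U (\<lambda>x. f x + g x)"
proof -
  obtain f' g' where "\<forall>x\<in>U. (f has_derivative blinfun_apply (f' x)) (at x)" "continuous_on U f'"
    "\<forall>x\<in>U. (g has_derivative blinfun_apply (g' x)) (at x)" "continuous_on U g'"
    using assms unfolding C1_on_def by blast
  then show ?thesis
    unfolding C1_on_def
    by (intro exI[of _ "\<lambda>x. f' x + g' x"])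
      (auto intro!: continuous_intros derivative_eq_intros simp: plus_blinfun.rep_eq)
qed

lemma C1_on_sum:
  assumes "\<And>i. i \<in> I \<Longrightarrow> C1_on U (f i)"
  shows "C1_on U (\<lambda>x. \<Sum>i\<in>I. f i x)"
  using assms
  by (induction I rule: infinite_finite_induct) (auto intro: C1_on_const C1_on_add)

lemma C1_on_bounded_linear:
  assumes "bounded_linear L" "C1_on U f"
  shows "C1_on U (\<lambda>x. L (f x))"
proof -
  obtain f' where f': "\<forall>x\<in>U. (f has_derivative blinfun_apply (f' x)) (at x)" "continuous_on U f'"
    using assms(2) unfolding C1_on_def by blast
  show ?thesis
    unfolding C1_on_def
  proof (intro exI[of _ "\<lambda>x. Blinfun L o\<^sub>L f' x"] conjI ballI)
    show "((\<lambda>x. L (f x)) has_derivative blinfun_apply (Blinfun L o\<^sub>L f' x)) (at x)" if "x \<in> U" for x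
      using bounded_linear.has_derivative[OF assms(1)] f'(1) that
      by (auto simp: bounded_linear_Blinfun_apply[OF assms(1)] blinfun_compose.rep_eq o_def)
    show "continuous_on U (\<lambda>x. Blinfun L o\<^sub>L f' x)"
      using f'(2) by (intro continuous_intros)
  qed
qed

lemma C1_on_linear:
  assumes "bounded_linear L"
  shows "C1_on U L"
  unfolding C1_on_def
  using bounded_linear_imp_has_derivative[OF assms]
  by (intro exI[of _ "\<lambda>x. Blinfun L"]) (simp add: bounded_linear_Blinfun_apply[OF assms])

lemma C1_on_diff:
  assumes "C1_on U f" "C1_on U g"
  shows "C1_on U (\<lambda>x. f x - g x)"
  using C1_on_add[OF assms(1) C1_on_bounded_linear[OF bounded_linear_minus[OF bounded_linear_ident] assms(2)]]
  by simp

lemma C1_on_Pair: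
  assumes "C1_on U f" "C1_on U g"
  shows "C1_on U (\<lambda>x. (f x, g x))"
proof -
  have "bounded_linear (\<lambda>v. (v, 0))" "bounded_linear (\<lambda>v. (0, v))"
    by (intro bounded_linear_intros)+
  from C1_on_add[OF C1_on_bounded_linear[OF this(1) assms(1)] C1_on_bounded_linear[OF this(2) assms(2)]]
  show ?thesis by simp
qed

lemma C1_on_cong:
  assumes "open U" "\<And>x. x \<in> U \<Longrightarrow> f x = g x" "C1_on U f"
  shows "C1_on U g"
  using assms(3) unfolding C1_on_def
  by (meson assms(1,2) has_derivative_transform_within_open)

lemma C1_on_compose_bounded_linear:
  assumes "bounded_linear L" "C1_on UNIV f"
  shows "C1_on UNIV (\<lambda>x. f (L x))"
proof -
  obtain f' where f': "\<forall>x. (f has_derivative blinfun_apply (f' x)) (at x)" "continuous_on UNIV f'"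
    using assms(2) unfolding C1_on_def by blast
  show ?thesis
    unfolding C1_on_def
  proof (intro exI[of _ "\<lambda>x. f' (L x) o\<^sub>L Blinfun L"] conjI ballI)
    show "((\<lambda>x. f (L x)) has_derivative blinfun_apply (f' (L x) o\<^sub>L Blinfun L)) (at x)" for x
      using has_derivative_compose[OF bounded_linear_imp_has_derivative[OF assms(1)], of f "f' (L x)" x UNIV] f'(1)
      by (simp add: bounded_linear_Blinfun_apply[OF assms(1)] blinfun_compose.rep_eq o_def)
    show "continuous_on UNIV (\<lambda>x. f' (L x) o\<^sub>L Blinfun L)"
      by (intro continuous_intros continuous_on_compose2[OF f'(2)] linear_continuous_on assms(1)) auto
  qed
qed

lemma C1_on_scaleR:
  fixes f :: "'a::real_normed_vector \<Rightarrow> real"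
  assumes f: "C1_on U f" and g: "C1_on U g"
  shows "C1_on U (\<lambda>x. f x *\<^sub>R g x)"
proof -
  obtain f' g' where f': "\<forall>x\<in>U. (f has_derivative blinfun_apply (f' x)) (at x)" "continuous_on U f'"
    and g': "\<forall>x\<in>U. (g has_derivative blinfun_apply (g' x)) (at x)" "continuous_on U g'"
    using assms unfolding C1_on_def by blast
  show ?thesis
    unfolding C1_on_def
  proof (intro exI[of _ "\<lambda>x. f x *\<^sub>R g' x + (blinfun_scaleR_left (g x) o\<^sub>L f' x)"] conjI ballI)
    show "((\<lambda>x. f x *\<^sub>R g x) has_derivative
        blinfun_apply (f x *\<^sub>R g' x + (blinfun_scaleR_left (g x) o\<^sub>L f' x))) (at x)" if "x \<in> U" for x
      using that f'(1) g'(1)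
      by (auto intro!: derivative_eq_intros simp: plus_blinfun.rep_eq scaleR_blinfun.rep_eq)
    show "continuous_on U (\<lambda>x. f x *\<^sub>R g' x + (blinfun_scaleR_left (g x) o\<^sub>L f' x))"
      using f'(2) g'(2) C1_on_continuous_on[OF f] C1_on_continuous_on[OF g]
      by (intro continuous_intros bounded_linear.continuous_on[OF bounded_linear_blinfun_scaleR_left])
  qed
qed

text \<open>The resolvent identity \<open>B y - B x = B y (A x - A y) B x\<close> reduces continuity
  of \<open>B\<close> to that of \<open>A\<close>, once \<open>B\<close> is known to be bounded near
  x.\<close>

lemma continuous_on_blinfun_inverse:
  fixes A :: "'c::topological_space \<Rightarrow> 'a::real_normed_vector \<Rightarrow>\<^sub>L 'b::real_normed_vector"
  assumes A: "continuous_on S A"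
    and left: "\<And>x. x \<in> S \<Longrightarrow> B x o\<^sub>L A x = id_blinfun"
    and right: "\<And>x. x \<in> S \<Longrightarrow> A x o\<^sub>L B x = id_blinfun"
  shows "continuous_on S B"
  unfolding continuous_on_def
proof
  fix x assume x: "x \<in> S"
  define K where "K = norm (B x)"
  have lim: "((\<lambda>y. norm (A y - A x)) \<longlongrightarrow> 0) (at x within S)"
    using A x unfolding continuous_on_def by (simp add: tendsto_norm_zero LIM_zero)
  have resolvent: "B y - B x = B y o\<^sub>L (A x - A y) o\<^sub>L B x" if "y \<in> S" for y
  proof (rule blinfun_eqI)
    fix v
    have "B y (A y w) = w" for w
      using left[OF that] by (metis blinfun_apply_blinfun_compose blinfun_apply_id_blinfun)
    moreover have "A x (B x v) = v"
      using right[OF x] by (metis blinfun_apply_blinfun_compose blinfun_apply_id_blinfun)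
    ultimately show "blinfun_apply (B y - B x) v = blinfun_apply (B y o\<^sub>L (A x - A y) o\<^sub>L B x) v"
      by (simp add: blinfun.diff_left blinfun.diff_right)
  qed
  have est: "norm (B y - B x) \<le> norm (B y) * norm (A y - A x) * K" if "y \<in> S" for y
  proof -
    have "norm (B y - B x) \<le> norm (B y o\<^sub>L (A x - A y)) * norm (B x)"
      unfolding resolvent[OF that] by (rule norm_blinfun_compose)
    also have "\<dots> \<le> (norm (B y) * norm (A x - A y)) * norm (B x)"
      by (intro mult_right_mono norm_blinfun_compose) simp
    finally show ?thesis by (simp add: K_def norm_minus_commute)
  qed
  have "\<forall>\<^sub>F y in at x within S. norm (A y - A x) * (K + 1) < 1 / 2"
    using tendsto_mult_left_zero[OF lim, of "K + 1"] order_tendstoD(2)[of _ 0 _ "1 / 2 :: real"] by simp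
  moreover have "\<forall>\<^sub>F y in at x within S. y \<in> S"
    by (simp add: eventually_at_filter)
  ultimately have "\<forall>\<^sub>F y in at x within S. norm (B y - B x) \<le> norm (A y - A x) * (2 * K * K)"
  proof eventually_elim
    case (elim y)
    \<comment> \<open>The threshold 1/2 lets half of \<open>norm (B y)\<close> be absorbed on the
      left, which yields \<open>norm (B y) \<le> 2 * K\<close>.\<close>
    have small: "norm (A y - A x) * K \<le> 1 / 2"
      using elim(1) norm_ge_zero[of "A y - A x"] unfolding distrib_left by linarith
    have "norm (B y) \<le> K + norm (B y - B x)"
      using norm_triangle_ineq[of "B x" "B y - B x"] by (simp add: K_def)
    also have "norm (B y - B x) \<le> norm (B y) * (1 / 2)"
      using est[OF elim(2)] mult_left_mono[OF small, of "norm (B y)"] by (simp add: mult.assoc)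
    finally have "norm (B y) \<le> 2 * K" by simp
    then have "norm (B y) * (norm (A y - A x) * K) \<le> 2 * K * (norm (A y - A x) * K)"
      by (intro mult_right_mono) (auto simp: K_def)
    then show ?case
      using est[OF elim(2)] by (simp add: algebra_simps)
  qed
  then have "((\<lambda>y. B y - B x) \<longlongrightarrow> 0) (at x within S)"
    by (rule Lim_null_comparison[OF _ tendsto_mult_left_zero[OF lim]])
  then show "(B \<longlongrightarrow> B x) (at x within S)"
    by (rule LIM_zero_cancel)
qed

text \<open>The inverse function theorem is applied to \<open>(x, w) \<mapsto> (x, F (x, w))\<close>
  and read on the slice where the second component is 0. The box inside \<open>N\<close> gives
  uniqueness among all w in \<open>W\<close>, from which isolation of the solution follows
  later.\<close>

lemma implicit_function_C1:
  fixes F :: "'a::euclidean_space \<times> 'b::euclidean_space \<Rightarrow> 'b"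
  assumes F: "C1_on UNIV F" "F (x0, w0) = 0"
    and inj: "\<And>w. frechet_derivative F (at (x0, w0)) (0, w) = 0 \<Longrightarrow> w = 0"
    and N: "open N" "(x0, w0) \<in> N"
  obtains \<sigma> U W where "open U" "x0 \<in> U" "open W" "w0 \<in> W" "U \<times> W \<subseteq> N" "C1_on U \<sigma>"
    and "\<And>x. x \<in> U \<Longrightarrow> \<sigma> x \<in> W"
    and "\<And>x w. x \<in> U \<Longrightarrow> w \<in> W \<Longrightarrow> F (x, w) = 0 \<longleftrightarrow> w = \<sigma> x"
proof -
  obtain F' where F': "\<And>z. (F has_derivative blinfun_apply (F' z)) (at z)" "continuous_on UNIV F'"
    using F(1) unfolding C1_on_def by blast
  define \<Phi> where "\<Phi> = (\<lambda>z. (fst z, F z))"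
  define E1 where "E1 = (Blinfun (\<lambda>v. (v, 0)) :: 'a \<Rightarrow>\<^sub>L ('a \<times> 'b))"
  define E2 where "E2 = (Blinfun (\<lambda>v. (0, v)) :: 'b \<Rightarrow>\<^sub>L ('a \<times> 'b))"
  define fst' where "fst' = (Blinfun fst :: ('a \<times> 'b) \<Rightarrow>\<^sub>L 'a)"
  have E1 [simp]: "blinfun_apply E1 v = (v, 0)" for v
    unfolding E1_def by (subst bounded_linear_Blinfun_apply) (auto intro: bounded_linear_intros)
  have E2 [simp]: "blinfun_apply E2 v = (0, v)" for v
    unfolding E2_def by (subst bounded_linear_Blinfun_apply) (auto intro: bounded_linear_intros)
  have fst' [simp]: "blinfun_apply fst' v = fst v" for v
    unfolding fst'_def by (subst bounded_linear_Blinfun_apply) (auto intro: bounded_linear_intros)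
  define \<Phi>' where "\<Phi>' = (\<lambda>z. (E1 o\<^sub>L fst') + (E2 o\<^sub>L F' z))"
  have \<Phi>'_apply: "blinfun_apply (\<Phi>' z) v = (fst v, F' z v)" for z v
    by (simp add: \<Phi>'_def plus_blinfun.rep_eq)
  have d\<Phi>: "(\<Phi> has_derivative blinfun_apply (\<Phi>' z)) (at z)" for z
  proof -
    have "((\<lambda>z. (fst z, F z)) has_derivative (\<lambda>v. (fst v, F' z v))) (at z)"
      by (intro has_derivative_Pair has_derivative_fst has_derivative_ident F'(1))
    then show ?thesis
      unfolding \<Phi>_def \<Phi>'_apply[of z, symmetric] .
  qed
  have c\<Phi>: "continuous_on UNIV \<Phi>'"
    unfolding \<Phi>'_def using F'(2) by (intro continuous_intros)
  have fr: "frechet_derivative F (at (x0, w0)) = F' (x0, w0)"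
    using frechet_derivative_at[OF F'(1)] by metis
  have "linear (blinfun_apply (\<Phi>' (x0, w0)))"
    by (simp add: blinfun.bounded_linear_right bounded_linear.linear)
  \<comment> \<open>The map is block triangular with the identity as first block, so its injectivity
    comes down to that of the partial derivative in w.\<close>
  moreover have "inj (blinfun_apply (\<Phi>' (x0, w0)))"
    unfolding linear_injective_0[OF \<open>linear (blinfun_apply (\<Phi>' (x0, w0)))\<close>]
  proof clarify
    fix a b assume "blinfun_apply (\<Phi>' (x0, w0)) (a, b) = 0"
    then have "a = 0 \<and> F' (x0, w0) (a, b) = 0"
      unfolding \<Phi>'_apply zero_prod_def fst_conv prod.inject .
    then have ab: "a = 0" "F' (x0, w0) (a, b) = 0" by blast+
    then have "b = 0" using inj[of b] unfolding fr ab(1) by simp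
    then show "(a, b) = 0" using ab(1) by (simp add: zero_prod_def)
  qed
  ultimately obtain L where L: "linear L" "L \<circ> blinfun_apply (\<Phi>' (x0, w0)) = id"
    using linear_injective_left_inverse by blast
  have "L (\<Phi>' (x0, w0) v) = v" for v
    using fun_cong[OF L(2), of v] unfolding o_apply id_apply .
  moreover have "blinfun_apply (Blinfun L) = L"
    using L(1) by (simp add: bounded_linear_Blinfun_apply linear_conv_bounded_linear)
  ultimately have inv: "Blinfun L o\<^sub>L \<Phi>' (x0, w0) = id_blinfun"
    by (intro blinfun_eqI) (simp add: blinfun_compose.rep_eq)
  obtain Z V \<Psi> \<Psi>' where Z: "open Z" "(x0, w0) \<in> Z" and V: "open V" "\<Phi> (x0, w0) \<in> V"
    and hom: "homeomorphism Z V \<Phi> \<Psi>"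
    and d\<Psi>: "\<And>y. y \<in> V \<Longrightarrow> (\<Psi> has_derivative \<Psi>' y) (at y)"
      "\<And>y. y \<in> V \<Longrightarrow> \<Psi>' y = inv (blinfun_apply (\<Phi>' (\<Psi> y)))"
      "\<And>y. y \<in> V \<Longrightarrow> bij (blinfun_apply (\<Phi>' (\<Psi> y)))"
    by (rule inverse_function_theorem[OF open_UNIV d\<Phi> c\<Phi> UNIV_I inv]) (rule that; assumption)
  have "(x0, w0) \<in> Z \<inter> N" "open (Z \<inter> N)" using Z N by auto
  then obtain U1 W where UW: "open U1" "open W" "x0 \<in> U1" "w0 \<in> W" "U1 \<times> W \<subseteq> Z \<inter> N"
    by (metis open_prod_elim mem_Sigma_iff)
  have \<Psi>\<Phi>: "\<Psi> (\<Phi> z) = z" if "z \<in> Z" for z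
    using hom that by (simp add: homeomorphism_def)
  have \<Phi>\<Psi>: "\<Phi> (\<Psi> v) = v" "\<Psi> v \<in> Z" if "v \<in> V" for v
    using hom that by (auto simp: homeomorphism_def)
  have \<Psi>_cont: "continuous_on V \<Psi>"
    using hom by (simp add: homeomorphism_def)
  define \<sigma> where "\<sigma> = (\<lambda>x. snd (\<Psi> (x, 0)))"
  define V0 where "V0 = {x. (x, 0) \<in> V}"
  \<comment> \<open>\<open>U\<close> keeps only those x whose solution lands in the chosen box, so
    that \<sigma> maps into \<open>W\<close>.\<close>
  define U where "U = {x \<in> V0. (\<lambda>x. \<Psi> (x, 0)) x \<in> U1 \<times> W}"
  have V0: "open V0"
  proof -
    have "continuous_on UNIV (\<lambda>x::'a. (x, 0::'b))"
      by (intro continuous_intros)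
    from open_vimage[OF V(1) this] show ?thesis
      by (simp add: V0_def vimage_def)
  qed
  have "continuous_on V0 (\<lambda>x. \<Psi> (x, 0))"
    by (intro continuous_on_compose2[OF \<Psi>_cont] continuous_intros) (auto simp: V0_def)
  then have openU: "open U"
    unfolding U_def using continuous_open_preimage[OF _ V0 open_Times[OF UW(1,2)]]
    by (simp add: vimage_def Int_def conj_commute)
  have \<Phi>0: "\<Phi> (x0, w0) = (x0, 0)" by (simp add: \<Phi>_def F(2))
  have x0U: "x0 \<in> U"
    using V(2) \<Psi>\<Phi>[OF Z(2)] UW(3,4) by (simp add: U_def V0_def \<Phi>0)
  have fst_\<Psi>: "fst (\<Psi> (x, 0)) = x" "F (\<Psi> (x, 0)) = 0" if "x \<in> V0" for x
    using \<Phi>\<Psi>(1)[of "(x, 0)"] that by (auto simp: V0_def \<Phi>_def)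
  have \<Psi>_eq: "\<Psi> (x, 0) = (x, \<sigma> x)" if "x \<in> V0" for x
    using fst_\<Psi>(1)[OF that] by (simp add: \<sigma>_def prod_eq_iff)
  have UV0: "U \<subseteq> V0" "U \<subseteq> U1"
    using \<Psi>_eq by (auto simp: U_def)
  define B where "B = (\<lambda>v. Blinfun (\<Psi>' v))"
  have B_apply: "blinfun_apply (B v) = \<Psi>' v" if "v \<in> V" for v
    unfolding B_def using d\<Psi>(1)[OF that] by (simp add: bounded_linear_Blinfun_apply has_derivative_bounded_linear)
  \<comment> \<open>The inverse function theorem gives the derivative of \<Psi> pointwise as an
    inverse; continuity of inversion makes it depend continuously on the point.\<close>
  have B_cont: "continuous_on V B"
  proof (rule continuous_on_blinfun_inverse)
    show "continuous_on V (\<lambda>v. \<Phi>' (\<Psi> v))"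
      by (rule continuous_on_compose2[OF c\<Phi> \<Psi>_cont]) simp
    show "B v o\<^sub>L \<Phi>' (\<Psi> v) = id_blinfun" "\<Phi>' (\<Psi> v) o\<^sub>L B v = id_blinfun" if "v \<in> V" for v
      using d\<Psi>(2,3)[OF that] B_apply[OF that]
      by (auto intro!: blinfun_eqI simp: bij_is_inj bij_is_surj surj_f_inv_f)
  qed
  have "C1_on U \<sigma>"
  proof -
    define snd' where "snd' = (Blinfun snd :: ('a \<times> 'b) \<Rightarrow>\<^sub>L 'b)"
    have snd' [simp]: "blinfun_apply snd' v = snd v" for v
      unfolding snd'_def by (subst bounded_linear_Blinfun_apply) (auto intro: bounded_linear_intros)
    show ?thesis
      unfolding C1_on_def
    proof (intro exI[of _ "\<lambda>x. snd' o\<^sub>L B (x, 0) o\<^sub>L E1"] conjI ballI)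
      fix x assume "x \<in> U"
      then have xV: "(x, 0) \<in> V" using UV0 by (auto simp: V0_def)
      have "((\<lambda>x. (x, 0)) has_derivative (\<lambda>v. (v, 0))) (at x)"
        by (auto intro!: derivative_eq_intros)
      from has_derivative_compose[OF this d\<Psi>(1)[OF xV]]
      have "((\<lambda>x. snd (\<Psi> (x, 0))) has_derivative (\<lambda>v. snd (\<Psi>' (x, 0) (v, 0)))) (at x)"
        by (rule has_derivative_snd)
      then show "(\<sigma> has_derivative blinfun_apply (snd' o\<^sub>L B (x, 0) o\<^sub>L E1)) (at x)"
        by (simp add: \<sigma>_def B_apply[OF xV] blinfun_compose.rep_eq o_def)
    next
      show "continuous_on U (\<lambda>x. snd' o\<^sub>L B (x, 0) o\<^sub>L E1)"
        using UV0 by (intro continuous_intros continuous_on_compose2[OF B_cont]) (auto simp: V0_def)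
    qed
  qed
  moreover have "\<sigma> x \<in> W" if "x \<in> U" for x
    using that \<Psi>_eq by (auto simp: U_def)
  moreover have "F (x, w) = 0 \<longleftrightarrow> w = \<sigma> x" if "x \<in> U" "w \<in> W" for x w
  proof
    assume "F (x, w) = 0"
    moreover have "(x, w) \<in> Z" using that UV0 UW(5) by auto
    ultimately show "w = \<sigma> x"
      using \<Psi>\<Phi>[of "(x, w)"] by (simp add: \<Phi>_def \<sigma>_def)
  next
    assume "w = \<sigma> x"
    then show "F (x, w) = 0"
      using fst_\<Psi>(2)[of x] \<Psi>_eq[of x] that UV0 by auto
  qed
  moreover have "U \<times> W \<subseteq> N" using UV0 UW(5) by auto
  ultimately show thesis
    using that openU x0U UW(2,4) by blast
qed

section \<open>Convexity of the solution sets\<close>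

lemma solution_map_iff:
  fixes g :: "(real^'n) \<times> (real^'m) \<Rightarrow> real" and G :: "(real^'n) \<times> (real^'m) \<Rightarrow> real^'s"
  shows
  "(y, p) \<in> solution_map g G h x \<longleftrightarrow>
    grad_y g x y + transpose (jac_y G x y) *v p = 0 \<and> G (x, y) \<in> subdifferential (conjugate h) p"
proof -
  have "0 = - a - b \<longleftrightarrow> a + b = 0" for a b :: "real^'m"
    by (metis add.inverse_inverse diff_conv_add_uminus minus_add_distrib neg_0_equal_iff_equal)
  moreover have "0 \<in> (\<lambda>u. - c + u) ` D \<longleftrightarrow> c \<in> D" for c :: "real^'s" and D
    by force
  ultimately show ?thesis
    unfolding solution_map_def mem_Collect_eq prod.case by presburger
qed

section \<open>Partial gradients and Jacobians\<close>

lemma gradient_eqI: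
  assumes "(f has_derivative (\<lambda>h. h \<bullet> D)) (at x)"
  shows "gradient f x = D"
  unfolding gradient_def
proof (rule the_equality)
  show "GDERIV f x :> D" using assms by (simp add: gderiv_def)
  fix E assume "GDERIV f x :> E"
  then have "(\<lambda>h. h \<bullet> E) = (\<lambda>h. h \<bullet> D)"
    using has_derivative_unique assms by (auto simp: gderiv_def)
  then show "E = D"
    by (metis vector_eq_ldot)
qed

lemma jacobian_mult_vec:
  fixes f :: "real^'a \<Rightarrow> real^'b"
  assumes "(f has_derivative f') (at x)"
  shows "jacobian f (at x) *v v = f' v"
proof -
  have "f differentiable (at x)"
    using assms by (rule differentiableI)
  then have "(f has_derivative (\<lambda>h. jacobian f (at x) *v h)) (at x)"
    by (simp add: jacobian_works)
  from has_derivative_unique[OF this assms] show ?thesis by metis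
qed

lemma has_derivative_partial_snd:
  assumes "(f has_derivative f') (at (x, y))"
  shows "((\<lambda>y'. f (x, y')) has_derivative (\<lambda>v. f' (0, v))) (at y)"
proof -
  have "((\<lambda>y'. (x, y')) has_derivative (\<lambda>v. (0, v))) (at y)"
    by (auto intro!: derivative_eq_intros)
  from has_derivative_compose[OF this assms] show ?thesis .
qed

lemma has_derivative_partial_fst:
  assumes "(f has_derivative f') (at (x, y))"
  shows "((\<lambda>x'. f (x', y)) has_derivative (\<lambda>v. f' (v, 0))) (at x)"
proof -
  have "((\<lambda>x'. (x', y)) has_derivative (\<lambda>v. (v, 0))) (at x)"
    by (auto intro!: derivative_eq_intros)
  from has_derivative_compose[OF this assms] show ?thesis .
qed

text \<open>The representing vector in coordinates. It makes a gradient an explicit linear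
  expression in the derivative, from which its continuous differentiability is read off
  later.\<close>

lemma linear_eq_inner_sum_axis:
  fixes f :: "real^'m \<Rightarrow> real"
  assumes "linear f"
  shows "f v = v \<bullet> (\<Sum>i\<in>UNIV. f (axis i 1) *\<^sub>R axis i 1)"
proof -
  have "f v = f (\<Sum>i\<in>UNIV. (v $ i) *\<^sub>R axis i 1)"
    using basis_expansion[of v] by (simp add: scalar_mult_eq_scaleR)
  also have "\<dots> = (\<Sum>i\<in>UNIV. v $ i * f (axis i 1))"
    using assms by (simp add: linear_sum linear_scale)
  finally show ?thesis
    by (simp add: inner_sum_right inner_axis mult.commute)
qed

lemma grad_y_eq:
  assumes "(g has_derivative g') (at (x, y))"
  shows "grad_y g x y = (\<Sum>i\<in>UNIV. g' (0, axis i 1) *\<^sub>R axis i 1)"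
    and "((\<lambda>y'. g (x, y')) has_derivative (\<lambda>v. v \<bullet> grad_y g x y)) (at y)"
proof -
  note d = has_derivative_partial_snd[OF assms]
  have "(\<lambda>v. g' (0, v)) = (\<lambda>v. v \<bullet> (\<Sum>i\<in>UNIV. g' (0, axis i 1) *\<^sub>R axis i 1))"
    by (intro ext) (rule linear_eq_inner_sum_axis[OF has_derivative_linear[OF d]])
  then have *: "((\<lambda>y'. g (x, y')) has_derivative (\<lambda>v. v \<bullet> (\<Sum>i\<in>UNIV. g' (0, axis i 1) *\<^sub>R axis i 1))) (at y)"
    using d by simp
  show eq: "grad_y g x y = (\<Sum>i\<in>UNIV. g' (0, axis i 1) *\<^sub>R axis i 1)"
    unfolding grad_y_def by (rule gradient_eqI[OF *])
  show "((\<lambda>y'. g (x, y')) has_derivative (\<lambda>v. v \<bullet> grad_y g x y)) (at y)"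
    using * unfolding eq .
qed

lemma jac_y_mult_vec:
  assumes "(G has_derivative G') (at (x, y))"
  shows "jac_y G x y *v v = G' (0, v)"
  unfolding jac_y_def by (rule jacobian_mult_vec[OF has_derivative_partial_snd[OF assms]])

lemma jac_x_mult_vec:
  assumes "(G has_derivative G') (at (x, y))"
  shows "jac_x G x y *v v = G' (v, 0)"
  unfolding jac_x_def by (rule jacobian_mult_vec[OF has_derivative_partial_fst[OF assms]])

lemma inner_transpose_mult_vec:
  fixes J :: "real^'m^'s"
  shows "v \<bullet> (transpose J *v p) = (J *v v) \<bullet> p"
proof -
  have "v \<bullet> (transpose J *v p) = (p v* J) \<bullet> v"
    by (simp add: inner_commute)
  also have "\<dots> = (J *v v) \<bullet> p"
    unfolding dot_lmul_matrix by (rule inner_commute)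
  finally show ?thesis .
qed

lemma has_derivative_y_real_lagrangian:
  assumes g: "(g has_derivative g') (at (x, y))" and G: "(G has_derivative G') (at (x, y))"
  shows "((\<lambda>y'. g (x, y') + G (x, y') \<bullet> p) has_derivative
          (\<lambda>v. v \<bullet> (grad_y g x y + transpose (jac_y G x y) *v p))) (at y)"
proof -
  have "((\<lambda>y'. g (x, y') + G (x, y') \<bullet> p) has_derivative
          (\<lambda>v. v \<bullet> grad_y g x y + G' (0, v) \<bullet> p)) (at y)"
    by (intro has_derivative_add grad_y_eq(2)[OF g] has_derivative_inner_left
        has_derivative_partial_snd[OF G])
  then show ?thesis
    unfolding inner_add_right inner_transpose_mult_vec jac_y_mult_vec[OF G] .
qed

text \<open>For fixed p with finite conjugate, the last term of the Lagrangian is a real constant in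
  y and drops out.\<close>

lemma lagrangian_grad_y_eq:
  assumes g: "(g has_derivative g') (at (x, y))" and G: "(G has_derivative G') (at (x, y))"
    and c: "conjugate h p = ereal c"
  shows "lagrangian_grad_y g G h x y p = grad_y g x y + transpose (jac_y G x y) *v p"
  unfolding lagrangian_grad_y_def
proof (rule gradient_eqI)
  have "(\<lambda>y'. real_of_ereal (lagrangian g G h x y' p)) = (\<lambda>y'. g (x, y') + G (x, y') \<bullet> p - c)"
    by (simp add: lagrangian_def c)
  then show "((\<lambda>y'. real_of_ereal (lagrangian g G h x y' p)) has_derivative
      (\<lambda>h. h \<bullet> (grad_y g x y + transpose (jac_y G x y) *v p))) (at y)"
    using has_derivative_diff[OF has_derivative_y_real_lagrangian[OF g G, of p] has_derivative_const[of c]]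
    by simp
qed

text \<open>Along the line through y and z the convex function lies above its tangent at y, which is
  horizontal.\<close>

lemma convex_critical_point_le:
  fixes f :: "'a::real_normed_vector \<Rightarrow> real"
  assumes f: "convex_on UNIV f" and d: "(f has_derivative (\<lambda>_. 0)) (at y)"
  shows "f y \<le> f z"
proof -
  define \<phi> where "\<phi> = (\<lambda>t::real. f (y + t *\<^sub>R (z - y)))"
  have "convex_on UNIV \<phi>"
  proof (rule convex_onI)
    fix t a b :: real assume t: "0 < t" "t < 1"
    have eq: "y + ((1 - t) *\<^sub>R a + t *\<^sub>R b) *\<^sub>R (z - y) =
        (1 - t) *\<^sub>R (y + a *\<^sub>R (z - y)) + t *\<^sub>R (y + b *\<^sub>R (z - y))"
      by (simp add: algebra_simps)
    show "\<phi> ((1 - t) *\<^sub>R a + t *\<^sub>R b) \<le> (1 - t) * \<phi> a + t * \<phi> b"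
      unfolding \<phi>_def eq using t by (intro convex_onD[OF f]) auto
  qed simp
  moreover have "(\<phi> has_real_derivative 0) (at 0)"
  proof -
    have 1: "((\<lambda>t::real. y + t *\<^sub>R (z - y)) has_derivative (\<lambda>t. t *\<^sub>R (z - y))) (at 0)"
      by (auto intro!: derivative_eq_intros)
    have "(f has_derivative (\<lambda>_. 0)) (at (y + 0 *\<^sub>R (z - y)))"
      using d by simp
    from has_derivative_compose[OF 1 this] show ?thesis
      by (simp add: \<phi>_def has_field_derivative_def flip: lambda_zero)
  qed
  ultimately have "\<phi> 1 - \<phi> 0 \<ge> 0 * (1 - 0)"
    by (intro convex_on_imp_above_tangent[where A = UNIV]) auto
  then show ?thesis by (simp add: \<phi>_def)
qed

text \<open>Lowering coordinate i of a point of the domain keeps \<open>h\<close> bounded above by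
  monotonicity, so a negative \<open>q $ i\<close> would make the supremum infinite.\<close>

lemma conjugate_finite_nonneg:
  fixes h :: "real^'s \<Rightarrow> ereal"
  assumes h: "proper h" "mono h" and q: "conjugate h q \<le> ereal c"
  shows "0 \<le> q $ i"
proof (rule ccontr)
  assume neg: "\<not> 0 \<le> q $ i"
  obtain z0 t0 where z0: "h z0 = ereal t0"
    using h(1) by (metis proper_def ereal_cases)
  have bound: "q \<bullet> z0 - s * q $ i - t0 \<le> c" if "s \<ge> 0" for s
  proof -
    have "z0 - s *\<^sub>R axis i 1 \<le> z0"
      using that by (simp add: less_eq_vec_def axis_def)
    then have "h (z0 - s *\<^sub>R axis i 1) \<le> ereal t0"
      using h(2) z0 by (metis monoD)
    then have "q \<bullet> (z0 - s *\<^sub>R axis i 1) - t0 \<le> c"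
      using q unfolding conjugate_le_iff[OF h(1)] epi_def by blast
    then show ?thesis by (simp add: inner_diff_right inner_axis)
  qed
  \<comment> \<open>Large enough that \<open>- s * q $ i\<close> exceeds
    \<open>c - q \<bullet> z0 + t0\<close>, against \<open>bound\<close>.\<close>
  define s where "s = (\<bar>c - q \<bullet> z0 + t0\<bar> + 1) / (- q $ i)"
  have "s \<ge> 0" unfolding s_def using neg by (intro divide_nonneg_nonneg) auto
  moreover have "s * q $ i = - (\<bar>c - q \<bullet> z0 + t0\<bar> + 1)"
    using neg by (simp add: s_def)
  ultimately show False using bound[of s] by linarith
qed

lemma conjugate_convex_bound:
  assumes h: "proper h" and p: "conjugate h p1 = ereal c1" "conjugate h p2 = ereal c2"
    and ab: "0 \<le> a" "0 \<le> b" "a + b = 1"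
  shows "conjugate h (a *\<^sub>R p1 + b *\<^sub>R p2) \<le> ereal (a * c1 + b * c2)"
  unfolding conjugate_le_iff[OF h]
proof clarify
  fix z t assume "(z, t) \<in> epi h"
  then have "p1 \<bullet> z - t \<le> c1" "p2 \<bullet> z - t \<le> c2"
    using conjugate_le_iff[OF h, of p1 c1] conjugate_le_iff[OF h, of p2 c2] p by auto
  then have "a * (p1 \<bullet> z - t) + b * (p2 \<bullet> z - t) \<le> a * c1 + b * c2"
    using ab by (intro add_mono mult_left_mono) auto
  moreover have "a * (p1 \<bullet> z - t) + b * (p2 \<bullet> z - t) = a * (p1 \<bullet> z) + b * (p2 \<bullet> z) - (a + b) * t"
    by (simp add: algebra_simps)
  ultimately show "(a *\<^sub>R p1 + b *\<^sub>R p2) \<bullet> z - t \<le> a * c1 + b * c2"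
    using ab(3) by (simp add: inner_add_left)
qed

text \<open>The solutions at \<open>x\<close> are the saddle points of the convex-concave function
  \<open>(y, p) \<mapsto> g (x, y) + G (x, y) \<bullet> p - h* p\<close>.\<close>

lemma convex_solution_map:
  fixes g :: "(real^'n) \<times> (real^'m) \<Rightarrow> real" and G :: "(real^'n) \<times> (real^'m) \<Rightarrow> real^'s"
  assumes g: "\<And>z. (g has_derivative g' z) (at z)" and G: "\<And>z. (G has_derivative G' z) (at z)"
    and g_convex: "convex_on UNIV (\<lambda>y. g (x, y))"
    and G_convex: "\<And>i. convex_on UNIV (\<lambda>y. G (x, y) $ i)"
    and h: "proper h" "mono h"
  shows "convex (solution_map g G h x)"
proof (rule convexI, clarify)
  fix y1 p1 y2 p2 and a b :: real
  assume S1: "(y1, p1) \<in> solution_map g G h x" and S2: "(y2, p2) \<in> solution_map g G h x"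
    and ab: "0 \<le> a" "0 \<le> b" "a + b = 1"
  define L where "L = (\<lambda>y q. g (x, y) + G (x, y) \<bullet> q)"
  \<comment> \<open>Nonnegative weights q turn the componentwise convexity of \<open>G\<close> into
    convexity of the weighted sum.\<close>
  have L_convex: "L (a *\<^sub>R y + b *\<^sub>R z) q \<le> a * L y q + b * L z q" if q: "\<And>i. 0 \<le> q $ i"
    and "0 \<le> a" "0 \<le> b" "a + b = 1" for y z q and a b :: real
  proof -
    have "g (x, a *\<^sub>R y + b *\<^sub>R z) \<le> a * g (x, y) + b * g (x, z)"
      using g_convex that unfolding convex_on_def by blast
    moreover have "G (x, a *\<^sub>R y + b *\<^sub>R z) \<bullet> q \<le> (a *\<^sub>R G (x, y) + b *\<^sub>R G (x, z)) \<bullet> q"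
      unfolding inner_vec_def
    proof (rule sum_mono)
      fix i
      have "G (x, a *\<^sub>R y + b *\<^sub>R z) $ i \<le> a * G (x, y) $ i + b * G (x, z) $ i"
        using G_convex[of i] that unfolding convex_on_def by blast
      then show "G (x, a *\<^sub>R y + b *\<^sub>R z) $ i \<bullet> q $ i \<le> (a *\<^sub>R G (x, y) + b *\<^sub>R G (x, z)) $ i \<bullet> q $ i"
        using q[of i] by (simp add: mult_right_mono)
    qed
    ultimately show ?thesis
      by (simp add: L_def inner_add_left algebra_simps)
  qed
  have L_affine: "L y (a *\<^sub>R p + b *\<^sub>R q) = a * L y p + b * L y q" if "a + b = 1" for y p q and a b :: real
  proof -
    have "L y (a *\<^sub>R p + b *\<^sub>R q) = (a + b) * g (x, y) + G (x, y) \<bullet> (a *\<^sub>R p + b *\<^sub>R q)"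
      using that by (simp add: L_def)
    then show ?thesis by (simp add: L_def inner_add_right algebra_simps)
  qed
  have dL: "((\<lambda>y'. L y' p) has_derivative
          (\<lambda>v. v \<bullet> (grad_y g x y + transpose (jac_y G x y) *v p))) (at y)" for y p
    unfolding L_def by (rule has_derivative_y_real_lagrangian[OF g G])
  have saddle: "\<exists>c. conjugate h p = ereal c \<and> (\<forall>z. L y p \<le> L z p) \<and>
      (\<forall>q d. conjugate h q = ereal d \<longrightarrow> L y q - d \<le> L y p - c)"
    if S: "(y, p) \<in> solution_map g G h x" for y p
  proof -
    have sub: "G (x, y) \<in> subdifferential (conjugate h) p"
      and grad: "grad_y g x y + transpose (jac_y G x y) *v p = 0"
      using S by (auto simp: solution_map_iff)
    obtain c where c: "conjugate h p = ereal c"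
      using sub by (cases "conjugate h p") (auto simp: subdifferential_def)
    have nonneg: "0 \<le> p $ i" for i
      using conjugate_finite_nonneg[OF h, of p c] c by simp
    have "convex_on UNIV (\<lambda>y. L y p)"
      unfolding convex_on_def using L_convex[OF nonneg] by simp
    moreover have "((\<lambda>y. L y p) has_derivative (\<lambda>_. 0)) (at y)"
      using dL[of p y] unfolding grad by simp
    ultimately have "L y p \<le> L z p" for z
      using convex_critical_point_le[of "\<lambda>y. L y p" y z] by blast
    moreover have "L y q - d \<le> L y p - c" if "conjugate h q = ereal d" for q d
    proof -
      have "ereal c + ereal (G (x, y) \<bullet> (q - p)) \<le> ereal d"
        using sub that c unfolding subdifferential_def mem_Collect_eq by metis
      then show ?thesis by (simp add: L_def inner_diff_right)
    qed
    ultimately show ?thesis using c by blast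
  qed
  obtain c1 where c1: "conjugate h p1 = ereal c1" "\<And>z. L y1 p1 \<le> L z p1"
      "\<And>q d. conjugate h q = ereal d \<Longrightarrow> L y1 q - d \<le> L y1 p1 - c1"
    using saddle[OF S1] by blast
  obtain c2 where c2: "conjugate h p2 = ereal c2" "\<And>z. L y2 p2 \<le> L z p2"
      "\<And>q d. conjugate h q = ereal d \<Longrightarrow> L y2 q - d \<le> L y2 p2 - c2"
    using saddle[OF S2] by blast
  define v where "v = L y1 p1 - c1"
  \<comment> \<open>Comparing the two saddle points through the crossed pairs
    \<open>(y2, p1)\<close> and \<open>(y1, p2)\<close> shows that they share one value.\<close>
  have v: "L y2 p2 - c2 = v"
    using c1(2)[of y2] c2(2)[of y1] c1(3)[OF c2(1)] c2(3)[OF c1(1)] unfolding v_def by linarith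
  define y where "y = a *\<^sub>R y1 + b *\<^sub>R y2"
  define p where "p = a *\<^sub>R p1 + b *\<^sub>R p2"
  define c where "c = a * c1 + b * c2"
  have low: "v + c \<le> L z p" for z
  proof -
    have "a * (v + c1) + b * (v + c2) \<le> a * L z p1 + b * L z p2"
      using c1(2)[of z] c2(2)[of z] v ab by (intro add_mono mult_left_mono) (auto simp: v_def)
    moreover have "a * (v + c1) + b * (v + c2) = (a + b) * v + c"
      by (simp add: c_def algebra_simps)
    ultimately show ?thesis
      using ab(3) by (simp add: p_def L_affine)
  qed
  have up: "L y q \<le> v + d" if q: "conjugate h q = ereal d" for q d
  proof -
    have "0 \<le> q $ i" for i
      using conjugate_finite_nonneg[OF h, of q d] q by simp
    then have "L y q \<le> a * L y1 q + b * L y2 q"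
      unfolding y_def using ab by (rule L_convex)
    also have "\<dots> \<le> a * (v + d) + b * (v + d)"
      using c1(3)[OF q] c2(3)[OF q] v ab by (intro add_mono mult_left_mono) (auto simp: v_def)
    also have "\<dots> = v + d"
      using ab(3) by (metis distrib_right mult_1)
    finally show ?thesis .
  qed
  have "conjugate h p \<le> ereal c"
    unfolding p_def c_def by (rule conjugate_convex_bound[OF h(1) c1(1) c2(1) ab])
  then obtain d where d: "conjugate h p = ereal d" "d \<le> c"
    using conjugate_not_MInf[OF h(1), of p] by (cases "conjugate h p") auto
  \<comment> \<open>\<open>low\<close> at y and \<open>up\<close> at p enclose \<open>L y p\<close>
    between \<open>v + c\<close> and \<open>v + d\<close>; with d at most c this forces d =
    c.\<close>
  have c: "conjugate h p = ereal c" and Lyp: "L y p = v + c"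
    using up[OF d(1)] low[of y] d by auto
  have "((\<lambda>y'. L y' p) has_derivative (\<lambda>v. v \<bullet> (grad_y g x y + transpose (jac_y G x y) *v p))) (at y)"
    by (rule dL)
  then have "(\<lambda>v. v \<bullet> (grad_y g x y + transpose (jac_y G x y) *v p)) = (\<lambda>v. 0)"
    by (rule has_derivative_local_min) (simp add: Lyp low)
  then have grad: "grad_y g x y + transpose (jac_y G x y) *v p = 0"
    by (metis inner_eq_zero_iff)
  have "ereal c + ereal (G (x, y) \<bullet> (q - p)) \<le> conjugate h q" for q
  proof (cases "conjugate h q")
    case (real d)
    then show ?thesis
      using up[OF real] Lyp by (simp add: L_def inner_diff_right)
  next
    case MInf
    then show ?thesis using conjugate_not_MInf[OF h(1)] by blast
  qed simp
  then have "G (x, y) \<in> subdifferential (conjugate h) p"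
    by (simp add: subdifferential_def c)
  then have "(y, p) \<in> solution_map g G h x"
    using grad by (simp add: solution_map_iff)
  then show "a *\<^sub>R (y1, p1) + b *\<^sub>R (y2, p2) \<in> solution_map g G h x"
    by (simp add: y_def p_def)
qed

text \<open>The segment from \<sigma> to any other point of \<open>C\<close> would meet
  \<open>W\<close> in points different from \<sigma>.\<close>

lemma convex_locally_singleton_imp_singleton:
  fixes C :: "'a::real_normed_vector set"
  assumes C: "convex C" and W: "open W" "\<sigma> \<in> W" "C \<inter> W = {\<sigma>}"
  shows "C = {\<sigma>}"
proof -
  have \<sigma>: "\<sigma> \<in> C" using W by blast
  have "z = \<sigma>" if z: "z \<in> C" for z
  proof (rule ccontr)
    assume "z \<noteq> \<sigma>"
    obtain e where e: "e > 0" "ball \<sigma> e \<subseteq> W"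
      using W(1,2) by (meson openE)
    define t where "t = min 1 (e / (2 * dist z \<sigma>))"
    have "dist z \<sigma> > 0" using \<open>z \<noteq> \<sigma>\<close> by simp
    then have t: "0 < t" "t \<le> 1" and "t \<le> e / (2 * dist z \<sigma>)"
      using e by (auto simp: t_def)
    then have "t * dist z \<sigma> \<le> e / 2"
      using \<open>dist z \<sigma> > 0\<close> by (simp add: field_simps)
    define w where "w = (1 - t) *\<^sub>R \<sigma> + t *\<^sub>R z"
    have "w - \<sigma> = t *\<^sub>R (z - \<sigma>)" by (simp add: w_def algebra_simps)
    then have "dist w \<sigma> = t * dist z \<sigma>" using t by (simp add: dist_norm)
    then have "w \<in> W" using e \<open>t * dist z \<sigma> \<le> e / 2\<close> by (auto simp: dist_commute)
    moreover have "w \<in> C"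
      unfolding w_def using C \<sigma> z t by (intro convexD) auto
    ultimately have "w = \<sigma>" using W(3) by blast
    then show False using \<open>w - \<sigma> = t *\<^sub>R (z - \<sigma>)\<close> t \<open>z \<noteq> \<sigma>\<close> by simp
  qed
  then show ?thesis using \<sigma> by blast
qed

section \<open>The linearised system\<close>

text \<open>\<open>P\<close> sums the components along an orthonormal basis. The kernels of
  \<open>P\<close> and of its residual are both recorded, so that membership in \<open>K\<close> or
  in its complement becomes a linear equation.\<close>

lemma orthogonal_projection_exists:
  fixes K :: "'a::euclidean_space set"
  assumes K: "subspace K"
  obtains P where "linear P" "\<And>v. P v = 0 \<longleftrightarrow> v \<in> orthogonal_comp K"
    and "\<And>v. P v \<in> K" "\<And>v. v - P v \<in> orthogonal_comp K" "\<And>v. v - P v = 0 \<longleftrightarrow> v \<in> K"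
proof -
  obtain B where B: "B \<subseteq> K" "pairwise orthogonal B" "\<And>x. x \<in> B \<Longrightarrow> norm x = 1"
      "independent B" "span B = K"
    using orthonormal_basis_subspace[OF K] by metis
  have fin: "finite B" using B(4) by (rule independent_imp_finite)
  define P where "P = (\<lambda>v. \<Sum>b\<in>B. (v \<bullet> b) *\<^sub>R b)"
  have lin: "linear P"
    unfolding P_def
    by (intro linearI) (simp_all add: inner_add_left scaleR_add_left sum.distrib scaleR_sum_right)
  have PK: "P v \<in> K" for v
    unfolding P_def using B(1) by (intro subspace_sum[OF K] subspace_scale[OF K]) auto
  have comp: "v - P v \<in> orthogonal_comp K" for v
  proof -
    have "b \<bullet> (v - P v) = 0" if b: "b \<in> B" for b
    proof -
      have "b \<bullet> P v = (\<Sum>c\<in>B. if c = b then v \<bullet> b else 0)"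
        unfolding P_def inner_sum_right
      proof (rule sum.cong)
        fix c assume "c \<in> B"
        then show "b \<bullet> (v \<bullet> c) *\<^sub>R c = (if c = b then v \<bullet> b else 0)"
          using B(2) b B(3)[OF b] by (auto simp: pairwise_def orthogonal_def norm_eq_1)
      qed simp
      then show ?thesis using fin b by (simp add: inner_diff_right inner_commute)
    qed
    then show ?thesis
      using orthogonal_comp_span[of B] B(5) by simp
  qed
  have both: "w = 0" if "w \<in> K" "w \<in> orthogonal_comp K" for w
    using that unfolding orthogonal_comp_def orthogonal_def by fastforce
  note sub = subspace_orthogonal_comp[of K]
  show thesis
  proof (rule that[OF lin _ PK comp])
    show "P v = 0 \<longleftrightarrow> v \<in> orthogonal_comp K" for v
      using comp[of v] both[OF PK[of v]] subspace_diff[OF sub _ comp[of v], of v] by auto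
    show "v - P v = 0 \<longleftrightarrow> v \<in> K" for v
      using both[OF _ comp[of v]] subspace_diff[OF K _ PK[of v], of v] PK[of v] by auto
  qed
qed

section \<open>Block vectors and block matrices\<close>

lemma sum_UNIV_Plus: "(\<Sum>k\<in>UNIV. f k) = (\<Sum>i\<in>UNIV. f (Inl i)) + (\<Sum>j\<in>UNIV. f (Inr j))"
  for f :: "'m::finite + 's::finite \<Rightarrow> 'b::comm_monoid_add"
  by (subst UNIV_Plus_UNIV[symmetric], subst sum.Plus) simp_all

lemma vstack_inner: "vstack a b \<bullet> vstack c d = a \<bullet> c + b \<bullet> d"
  for a c :: "real^'m" and b d :: "real^'s"
  by (simp add: inner_vec_def sum_UNIV_Plus vstack_def)

lemma vstack_mult_vec: "vstack M N *v v = vstack (M *v v) (N *v v)"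
  for M :: "real^'r^'m" and N :: "real^'r^'s"
  by (auto simp: vec_eq_iff vstack_def matrix_vector_mult_def split: sum.split)

lemma hstack_mult_vstack: "hstack M N *v vstack a b = M *v a + N *v b"
  for M :: "real^'m^'r" and N :: "real^'s^'r"
  by (simp add: vec_eq_iff vstack_def hstack_def matrix_vector_mult_def sum_UNIV_Plus)

lemma vstack_add: "vstack a b + vstack c d = vstack (a + c) (b + d)"
  for a c :: "real^'m" and b d :: "real^'s"
  by (auto simp: vec_eq_iff vstack_def split: sum.split)

lemma vstack_eq_0_iff: "vstack a b = 0 \<longleftrightarrow> a = 0 \<and> b = 0"
  for a :: "real^'m" and b :: "real^'s"
proof -
  have "vstack a b = 0 \<longleftrightarrow> vstack a b \<bullet> vstack a b = 0"
    by (rule inner_eq_zero_iff[symmetric])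
  then show ?thesis
    by (simp add: vstack_inner add_nonneg_eq_0_iff)
qed

lemma bounded_linear_vstack:
  "bounded_linear (\<lambda>v::(real^'m) \<times> (real^'s). vstack (fst v) (snd v))"
proof -
  have "linear (\<lambda>v::(real^'m) \<times> (real^'s). vstack (fst v) (snd v))"
    by (rule linearI) (auto simp: vec_eq_iff vstack_def split: sum.split)
  then show ?thesis by (simp add: linear_conv_bounded_linear)
qed

lemma matrix_mult_vec_minus: "A *v (- x) = - (A *v x)" for A :: "real^'n^'m"
  by (simp add: vec_eq_iff matrix_vector_mult_def sum_negf)

lemma minus_matrix_mult_vec: "(- A) *v x = - (A *v x)" for A :: "real^'n^'m"
  by (simp add: vec_eq_iff matrix_vector_mult_def sum_negf)

text \<open>The first block of the subspace is unrestricted: testing with \<open>w = a\<close> and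
  \<open>z = 0\<close> kills a, and testing with \<open>w = 0\<close> leaves the condition on
  b.\<close>

lemma vstack_in_orthogonal_comp:
  fixes K :: "(real^'s) set" and a :: "real^'m"
  assumes "0 \<in> K"
  shows "vstack a b \<in> orthogonal_comp {vstack w z | w z. z \<in> K} \<longleftrightarrow> a = 0 \<and> b \<in> orthogonal_comp K"
proof
  assume *: "vstack a b \<in> orthogonal_comp {vstack w z | w z. z \<in> K}"
  then have "w \<bullet> a + z \<bullet> b = 0" if "z \<in> K" for w z
    using that unfolding orthogonal_comp_def orthogonal_def by (force simp flip: vstack_inner)
  from this[OF assms, of a] this[of _ 0] show "a = 0 \<and> b \<in> orthogonal_comp K"
    by (simp add: orthogonal_comp_def orthogonal_def)
qed (auto simp: orthogonal_comp_def orthogonal_def vstack_inner)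

lemma matrix_inv_left:
  fixes A :: "'a::semiring_1^'n^'m"
  assumes "invertible A"
  shows "matrix_inv A ** A = mat 1"
proof -
  have "\<exists>A'. A ** A' = mat 1 \<and> A' ** A = mat 1"
    using assms by (simp add: invertible_def)
  from someI_ex[OF this] show ?thesis
    unfolding matrix_inv_def by blast
qed

lemma columns_form_basisD:
  fixes B :: "real^'k^'r"
  assumes B: "columns_form_basis B V"
  shows "V = range (\<lambda>c. B *v c)" and "B *v c = 0 \<Longrightarrow> c = 0"
proof -
  have inj: "inj (\<lambda>k. column k B)" and ind: "independent (columns B)" and V: "span (columns B) = V"
    using B by (auto simp: columns_form_basis_def)
  have "subspace (range (\<lambda>c. B *v c))"
    by (intro linear_subspace_image) (auto simp: matrix_vector_mul_linear)
  then have "span (columns B) \<subseteq> range (\<lambda>c. B *v c)"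
    by (intro span_minimal) (auto simp: columns_image_basis)
  then show "V = range (\<lambda>c. B *v c)"
    using matrix_vector_mult_in_columnspace[of B] V by auto
  assume c: "B *v c = 0"
  have cols: "columns B = range (\<lambda>k. column k B)"
    by (auto simp: columns_def)
  \<comment> \<open>Independence concerns the set of columns; since they are distinct, coefficients
    can be transported from indices to vectors.\<close>
  define u where "u = (\<lambda>v. c $ inv (\<lambda>k. column k B) v)"
  have u: "u (column k B) = c $ k" for k
    unfolding u_def by (simp only: inv_f_f[OF inj])
  have "(\<Sum>v\<in>columns B. u v *\<^sub>R v) = (\<Sum>k\<in>UNIV. c $ k *\<^sub>R column k B)"
    unfolding cols by (subst sum.reindex[OF inj]) (simp add: u)
  also have "\<dots> = 0"
    using c by (simp add: matrix_mult_sum scalar_mult_eq_scaleR)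
  finally have "u v = 0" if "v \<in> columns B" for v
    using independentD[OF ind, of "columns B" u] that by (simp add: cols)
  then have "c $ k = 0" for k
    using u[of k] by (simp add: cols)
  then show "c = 0" by (simp add: vec_eq_iff)
qed

text \<open>Orthogonality to the column space means annihilation by the transpose of
  \<open>B\<close>. With \<open>v = B *v c\<close> the problem becomes a square system for c, whose
  matrix is injective by \<open>nondeg\<close>.\<close>

lemma reduced_linear_system:
  fixes A :: "real^'r^'r" and B :: "real^'k^'r"
  assumes B: "columns_form_basis B V"
    and nondeg: "\<And>v. v \<in> V \<Longrightarrow> A *v v \<in> orthogonal_comp V \<Longrightarrow> v = 0"
  shows "invertible (transpose B ** A ** B)"
    and "v \<in> V \<Longrightarrow> A *v v + m \<in> orthogonal_comp V \<Longrightarrow>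
      v = - (B *v (matrix_inv (transpose B ** A ** B) *v (transpose B *v m)))"
proof -
  define N where "N = transpose B ** A ** B"
  note V = columns_form_basisD(1)[OF B]
  have comp: "w \<in> orthogonal_comp V \<longleftrightarrow> transpose B *v w = 0" for w
  proof -
    have "w \<in> orthogonal_comp V \<longleftrightarrow> (\<forall>c. c \<bullet> (transpose B *v w) = 0)"
      unfolding V orthogonal_comp_def orthogonal_def inner_transpose_mult_vec by auto
    also have "\<dots> \<longleftrightarrow> transpose B *v w = 0"
      using vector_eq_ldot[of "transpose B *v w" 0] by (simp del: transpose_matrix_vector)
    finally show ?thesis .
  qed
  have N: "N *v c = transpose B *v (A *v (B *v c))" for c
    by (simp only: N_def matrix_vector_mul_assoc matrix_mul_assoc)
  have "c = 0" if "N *v c = 0" for c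
  proof -
    have "B *v c \<in> V" using V by blast
    moreover have "A *v (B *v c) \<in> orthogonal_comp V"
      using that unfolding comp N .
    ultimately have "B *v c = 0" by (rule nondeg)
    then show ?thesis by (rule columns_form_basisD(2)[OF B])
  qed
  then show inv: "invertible (transpose B ** A ** B)"
    unfolding N_def[symmetric] invertible_left_inverse matrix_left_invertible_ker by blast
  assume "v \<in> V" and orth: "A *v v + m \<in> orthogonal_comp V"
  then obtain c where c: "v = B *v c" using V by blast
  have "N *v c + transpose B *v m = 0"
    using orth unfolding comp c N by (simp only: matrix_vector_right_distrib)
  then have "N *v c = - (transpose B *v m)"
    by (rule eq_neg_iff_add_eq_0[THEN iffD2])
  then have "matrix_inv N *v (N *v c) = - (matrix_inv N *v (transpose B *v m))"
    by (simp only: matrix_mult_vec_minus)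
  then have "c = - (matrix_inv N *v (transpose B *v m))"
    using matrix_inv_left[OF inv] by (simp only: matrix_vector_mul_assoc N_def[symmetric] matrix_vector_mul_lid)
  then show "v = - (B *v (matrix_inv (transpose B ** A ** B) *v (transpose B *v m)))"
    unfolding N_def[symmetric] c by (simp only: matrix_mult_vec_minus)
qed

text \<open>The y-gradient of the Lagrangian with the conjugate left out. Under the C2 assumptions
  it is smooth in all variables, even at multipliers where the conjugate is infinite, which suits
  the implicit function theorem.\<close>

definition y_stationarity ::
  "((real^'n) \<times> (real^'m) \<Rightarrow> real) \<Rightarrow> ((real^'n) \<times> (real^'m) \<Rightarrow> real^'s) \<Rightarrow>
   (real^'n) \<times> (real^'m) \<times> (real^'s) \<Rightarrow> real^'m" where
  "y_stationarity g G = (\<lambda>(x, y, p). grad_y g x y + transpose (jac_y G x y) *v p)"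

text \<open>In coordinates the two terms are finite sums of bounded linear images of the first
  derivatives of \<open>g\<close> and \<open>G\<close>, which are C1 by assumption; p enters as a
  linear factor.\<close>

lemma C1_on_y_stationarity:
  fixes g :: "(real^'n) \<times> (real^'m) \<Rightarrow> real" and G :: "(real^'n) \<times> (real^'m) \<Rightarrow> real^'s"
  assumes g: "C2_on UNIV g" and G: "C2_on UNIV G"
  shows "C1_on UNIV (y_stationarity g G)"
proof -
  obtain g' where g': "\<And>z. (g has_derivative blinfun_apply (g' z)) (at z)" "C1_on UNIV g'"
    using g unfolding C2_on_def by blast
  obtain G' where G': "\<And>z. (G has_derivative blinfun_apply (G' z)) (at z)" "C1_on UNIV G'"
    using G unfolding C2_on_def by blast
  have transp: "transpose (jac_y G x y) *v p =
      (\<Sum>j\<in>UNIV. p $ j *\<^sub>R (\<Sum>i\<in>UNIV. (G' (x, y) (0, axis i 1) $ j) *\<^sub>R axis i 1))" for x y p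
  proof (rule vector_eq_ldot[THEN iffD1], rule allI)
    fix v
    have "linear (\<lambda>v. G' (x, y) (0, v) $ j)" for j
      using linear_compose[OF has_derivative_linear[OF has_derivative_partial_snd[OF G'(1)]]
          bounded_linear.linear[OF bounded_linear_vec_nth]]
      by (simp add: o_def)
    then have "G' (x, y) (0, v) $ j = v \<bullet> (\<Sum>i\<in>UNIV. (G' (x, y) (0, axis i 1) $ j) *\<^sub>R axis i 1)" for j
      by (rule linear_eq_inner_sum_axis)
    then show "v \<bullet> (transpose (jac_y G x y) *v p) =
        v \<bullet> (\<Sum>j\<in>UNIV. p $ j *\<^sub>R (\<Sum>i\<in>UNIV. (G' (x, y) (0, axis i 1) $ j) *\<^sub>R axis i 1))"
      unfolding inner_transpose_mult_vec jac_y_mult_vec[OF G'(1)] inner_sum_right[of v _ UNIV] inner_scaleR_right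
      by (simp add: inner_vec_def mult.commute)
  qed
  have bl: "bounded_linear (\<lambda>z::(real^'n) \<times> (real^'m) \<times> (real^'s). (fst z, fst (snd z)))"
    by (intro bounded_linear_intros)
  have blT: "bounded_linear (\<lambda>T::((real^'n) \<times> (real^'m)) \<Rightarrow>\<^sub>L real. T v *\<^sub>R w)" for v and w :: "real^'m"
    by (intro bounded_linear_scaleR_const blinfun.bounded_linear_left)
  have blTs: "bounded_linear (\<lambda>T::((real^'n) \<times> (real^'m)) \<Rightarrow>\<^sub>L (real^'s). (T v $ j) *\<^sub>R w)"
    for v j and w :: "real^'m"
    by (intro bounded_linear_scaleR_const bounded_linear_compose[OF bounded_linear_vec_nth]
        blinfun.bounded_linear_left)
  have blp: "bounded_linear (\<lambda>z::(real^'n) \<times> (real^'m) \<times> (real^'s). snd (snd z) $ j)" for j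
    by (intro bounded_linear_compose[OF bounded_linear_vec_nth] bounded_linear_intros)
  have 1: "C1_on UNIV (\<lambda>z::(real^'n) \<times> (real^'m) \<times> (real^'s). g' (fst z, fst (snd z)) (0, axis i 1) *\<^sub>R (axis i 1 :: real^'m))" for i
    by (rule C1_on_bounded_linear[OF blT C1_on_compose_bounded_linear[OF bl g'(2)]])
  have 2: "C1_on UNIV (\<lambda>z::(real^'n) \<times> (real^'m) \<times> (real^'s). (G' (fst z, fst (snd z)) (0, axis i 1) $ j) *\<^sub>R (axis i 1 :: real^'m))" for i j
    by (rule C1_on_bounded_linear[OF blTs C1_on_compose_bounded_linear[OF bl G'(2)]])
  have "C1_on UNIV (\<lambda>z. (\<Sum>i\<in>UNIV. g' (fst z, fst (snd z)) (0, axis i 1) *\<^sub>R (axis i 1 :: real^'m)) +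
      (\<Sum>j\<in>UNIV. snd (snd z) $ j *\<^sub>R (\<Sum>i\<in>UNIV. (G' (fst z, fst (snd z)) (0, axis i 1) $ j) *\<^sub>R (axis i 1 :: real^'m))))"
    by (intro C1_on_add C1_on_sum C1_on_scaleR[OF C1_on_linear[OF blp]] 1 2)
  then show ?thesis
    unfolding y_stationarity_def case_prod_beta grad_y_eq(1)[OF g'(1)] transp .
qed

text \<open>The blocks in x and y are computed at fixed p, where the conjugate is finite and the map
  agrees with \<open>lagrangian_grad_y\<close> at all x and y; in p the map is affine.\<close>

lemma y_stationarity_derivative:
  fixes g :: "(real^'n) \<times> (real^'m) \<Rightarrow> real" and G :: "(real^'n) \<times> (real^'m) \<Rightarrow> real^'s"
  assumes g: "\<And>z. (g has_derivative g' z) (at z)" and G: "\<And>z. (G has_derivative G' z) (at z)"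
    and c: "conjugate h p = ereal c"
    and \<psi>: "(y_stationarity g G has_derivative \<psi>') (at (x, y, p))"
  shows "\<psi>' (\<xi>, w, z) = lagrangian_jac_xy g G h x y p *v \<xi> + lagrangian_hess_yy g G h x y p *v w +
    transpose (jac_y G x y) *v z"
proof -
  have lag: "lagrangian_grad_y g G h x' y' p = y_stationarity g G (x', y', p)" for x' y'
    using lagrangian_grad_y_eq[OF g G c] by (simp add: y_stationarity_def)
  note snd = has_derivative_partial_snd[OF \<psi>]
  have "lagrangian_jac_xy g G h x y p *v \<xi> = \<psi>' (\<xi>, 0)"
    unfolding lagrangian_jac_xy_def lag by (rule jacobian_mult_vec[OF has_derivative_partial_fst[OF \<psi>]])
  moreover have "lagrangian_hess_yy g G h x y p *v w = \<psi>' (0, w, 0)"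
    unfolding lagrangian_hess_yy_def lag by (rule jacobian_mult_vec[OF has_derivative_partial_fst[OF snd]])
  moreover have "transpose (jac_y G x y) *v z = \<psi>' (0, 0, z)"
  proof -
    have "((\<lambda>p'. grad_y g x y + transpose (jac_y G x y) *v p') has_derivative
        (\<lambda>z. transpose (jac_y G x y) *v z)) (at p)"
      by (auto intro!: derivative_eq_intros bounded_linear_imp_has_derivative
          simp del: transpose_matrix_vector)
    moreover have "((\<lambda>p'. grad_y g x y + transpose (jac_y G x y) *v p') has_derivative
        (\<lambda>z. \<psi>' (0, 0, z))) (at p)"
      using has_derivative_partial_snd[OF snd] by (simp add: y_stationarity_def)
    ultimately show ?thesis
      using has_derivative_unique by metis
  qed
  moreover have "\<psi>' (\<xi>, w, z) = \<psi>' (\<xi>, 0) + (\<psi>' (0, w, 0) + \<psi>' (0, 0, z))"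
    using has_derivative_linear[OF \<psi>] by (simp flip: linear_add add: zero_prod_def)
  ultimately show ?thesis by (simp add: add.assoc)
qed

section \<open>The solution map\<close>

text \<open>\<open>the_elem\<close> reads off the value where the solution set is a singleton, and
  \<open>vstack\<close> turns the pair into one vector so that it has a Jacobian matrix.
  Invertibility is asserted along with the formula, because it is what gives
  \<open>matrix_inv\<close> its meaning.\<close>

theorem theorem3p3:
  fixes g :: "(real^'n) \<times> (real^'m) \<Rightarrow> real"
    and G :: "(real^'n) \<times> (real^'m) \<Rightarrow> real^'s"
    and h :: "real^'s \<Rightarrow> ereal"
    and x :: "real^'n" and y :: "real^'m" and p :: "real^'s"
  assumes g_C2: "C2_on UNIV g"
    and G_C2: "C2_on UNIV G"
    and g_convex: "\<And>x. convex_on UNIV (\<lambda>y. g (x, y))"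
    and G_convex: "\<And>x i. convex_on UNIV (\<lambda>y. G (x, y) $ i)"
    and h_proper: "proper h"
    and h_polyhedral: "epi_polyhedral h"
    and h_nondecreasing: "mono h"
    and solution: "(y, p) \<in> solution_map g G h x"
    and basic_qualification:
      "\<And>u. u \<in> horizon_subdifferential h (G (x, y)) \<Longrightarrow> transpose (jac_y G x y) *v u = 0 \<Longrightarrow> u = 0"
    and ri_condition: "G (x, y) \<in> rel_interior (subdifferential (conjugate h) p)"
    and second_order:
      "\<And>w z. z \<in> critical_cone (conjugate h) p (G (x, y)) \<Longrightarrow>
         - (transpose (jac_y G x y) *v z) = lagrangian_hess_yy g G h x y p *v w \<Longrightarrow>
         - (jac_y G x y *v w) \<in> orthogonal_comp (critical_cone (conjugate h) p (G (x, y))) \<Longrightarrow>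
         w = 0 \<and> z = 0"
  shows "solution_map g G h x = {(y, p)} \<and>
    (\<exists>U. open U \<and> x \<in> U \<and>
       (\<forall>x'\<in>U. is_singleton (solution_map g G h x')) \<and>
       C1_on U (\<lambda>x'. the_elem (solution_map g G h x'))) \<and>
    (\<forall>B :: real^'k^('m + 's).
       columns_form_basis B
         {vstack w z | w z. z \<in> critical_cone (conjugate h) p (G (x, y))} \<longrightarrow>
       invertible (transpose B ** kkt_matrix g G h x y p ** B) \<and>
       jacobian (\<lambda>x'. case the_elem (solution_map g G h x') of (y', p') \<Rightarrow> vstack y' p') (at x) =
         - (B ** matrix_inv (transpose B ** kkt_matrix g G h x y p ** B) ** transpose B **
            vstack (lagrangian_jac_xy g G h x y p) (jac_x G x y)))"
proof -
  define u where "u = G (x, y)"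
  define K where "K = critical_cone (conjugate h) p u"
  define H where "H = lagrangian_hess_yy g G h x y p"
  define J where "J = jac_y G x y"
  let ?\<psi> = "y_stationarity g G"
  obtain g' where g': "\<And>z. (g has_derivative blinfun_apply (g' z)) (at z)"
    using g_C2 unfolding C2_on_def by blast
  obtain G' where G': "\<And>z. (G has_derivative blinfun_apply (G' z)) (at z)"
    using G_C2 unfolding C2_on_def by blast
  have \<psi>_C1: "C1_on UNIV ?\<psi>"
    by (rule C1_on_y_stationarity[OF g_C2 G_C2])
  then obtain \<psi>' where \<psi>': "\<And>z. (?\<psi> has_derivative blinfun_apply (\<psi>' z)) (at z)"
    unfolding C1_on_def by blast
  have ri: "u \<in> rel_interior (subdifferential (conjugate h) p)"
    using ri_condition by (simp add: u_def)
  have sol_iff: "(y', p') \<in> solution_map g G h x' \<longleftrightarrow>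
      ?\<psi> (x', y', p') = 0 \<and> G (x', y') \<in> subdifferential (conjugate h) p'" for x' y' p'
    by (simp add: solution_map_iff y_stationarity_def)
  obtain c where c: "conjugate h p = ereal c"
    using solution unfolding sol_iff subdifferential_def by (cases "conjugate h p") auto
  have "K = orthogonal_comp (span ((\<lambda>z. z - u) ` subdifferential (conjugate h) p))"
    unfolding K_def critical_cone_def by (rule normal_cone_rel_interior_eq_orthogonal_comp[OF ri])
  then have K: "subspace K"
    by (simp add: subspace_orthogonal_comp)
  obtain P where P: "linear P" "\<And>v. P v = 0 \<longleftrightarrow> v \<in> orthogonal_comp K" "\<And>v. P v \<in> K"
      "\<And>v. v - P v \<in> orthogonal_comp K" "\<And>v. v - P v = 0 \<longleftrightarrow> v \<in> K"
    using orthogonal_projection_exists[OF K] by metis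
  \<comment> \<open>The left side lies in the complement of \<open>K\<close> and the right side in
    \<open>K\<close>, so equality makes both zero.\<close>
  have residual_eq_iff: "q - P q = P v \<longleftrightarrow> q \<in> K \<and> v \<in> orthogonal_comp K" for q v
  proof
    assume *: "q - P q = P v"
    then have "P v \<bullet> P v = 0"
      using P(3)[of v] P(4)[of q] unfolding orthogonal_comp_def orthogonal_def by auto
    then have "P v = 0" by simp
    with * show "q \<in> K \<and> v \<in> orthogonal_comp K"
      using P(2)[of v] P(5)[of q] by simp
  qed (use P(2)[of v] P(5)[of q] in simp)
  obtain \<delta> where \<delta>: "\<delta> > 0" and graph: "\<And>p' u'. dist p' p < \<delta> \<Longrightarrow> dist u' u < \<delta> \<Longrightarrow>
      u' \<in> subdifferential (conjugate h) p' \<longleftrightarrow> p' - p \<in> K \<and> u' - u \<in> orthogonal_comp K"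
    using polyhedral_subdifferential_graph_locally_affine[OF h_proper h_polyhedral ri]
    unfolding K_def by blast
  define R where "R = (\<lambda>v. v - P v)"
  define F where "F = (\<lambda>z. (?\<psi> z, R (snd (snd z) - p) - P (G (fst z, fst (snd z)) - u)))"
  \<comment> \<open>Inside \<open>N\<close> the local affine description of the graph applies, so
    there the zeros of \<open>F\<close> are exactly the solutions.\<close>
  define N where "N = {z. dist (snd (snd z)) p < \<delta>} \<inter> {z. dist (G (fst z, fst (snd z))) u < \<delta>}"
  have F_iff: "F (x', w) = 0 \<longleftrightarrow> w \<in> solution_map g G h x'" if "(x', w) \<in> N" for x' w
  proof (cases w)
    case (Pair y' p')
    then show ?thesis
      using that graph[of p' "G (x', y')"]
      by (simp add: F_def N_def sol_iff R_def residual_eq_iff zero_prod_def)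
  qed
  have blP: "bounded_linear P"
    using P(1) by (simp add: linear_conv_bounded_linear)
  have blR: "bounded_linear R"
    unfolding R_def using blP by (intro bounded_linear_sub bounded_linear_ident)
  have bl: "bounded_linear (\<lambda>z::(real^'n) \<times> (real^'m) \<times> (real^'s). (fst z, fst (snd z)))"
    and blp: "bounded_linear (\<lambda>z::(real^'n) \<times> (real^'m) \<times> (real^'s). snd (snd z))"
    by (intro bounded_linear_intros)+
  have G_C1: "C1_on UNIV (\<lambda>z::(real^'n) \<times> (real^'m) \<times> (real^'s). G (fst z, fst (snd z)))"
    by (rule C1_on_compose_bounded_linear[OF bl C2_on_imp_C1_on[OF G_C2]])
  have F_C1: "C1_on UNIV F"
    unfolding F_def
    by (intro C1_on_Pair C1_on_diff \<psi>_C1 C1_on_bounded_linear[OF blR] C1_on_bounded_linear[OF blP]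
        C1_on_linear[OF blp] G_C1 C1_on_const)
  have "open N"
    unfolding N_def using C1_on_continuous_on[OF G_C1]
    by (intro open_Int open_Collect_less continuous_intros) auto
  have xyN: "(x, y, p) \<in> N" using \<delta> by (simp add: N_def u_def)
  have F0: "F (x, y, p) = 0" using F_iff[OF xyN] solution by simp
  define F' where "F' = (\<lambda>d. (\<psi>' (x, y, p) d, R (snd (snd d)) - P (G' (x, y) (fst d, fst (snd d)))))"
  have dF: "(F has_derivative F') (at (x, y, p))"
  proof -
    have "((\<lambda>z. G (fst z, fst (snd z))) has_derivative (\<lambda>d. G' (x, y) (fst d, fst (snd d)))) (at (x, y, p))"
      using has_derivative_compose[OF bounded_linear_imp_has_derivative[OF bl], of G "G' (x, y)" "(x, y, p)" UNIV] G'
      by simp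
    then have "((\<lambda>z. G (fst z, fst (snd z)) - u) has_derivative (\<lambda>d. G' (x, y) (fst d, fst (snd d)))) (at (x, y, p))"
      by (auto intro!: derivative_eq_intros)
    moreover have "((\<lambda>z::(real^'n) \<times> (real^'m) \<times> (real^'s). snd (snd z) - p) has_derivative (\<lambda>d. snd (snd d))) (at (x, y, p))"
      by (auto intro!: derivative_eq_intros)
    ultimately show ?thesis
      unfolding F_def F'_def
      by (intro has_derivative_Pair has_derivative_diff \<psi>' bounded_linear.has_derivative[OF blR]
          bounded_linear.has_derivative[OF blP])
  qed
  \<comment> \<open>Since \<open>R\<close> and \<open>P\<close> are linear,
    \<open>residual_eq_iff\<close> splits the second component of the derivative just as it splits
    that of \<open>F\<close>.\<close>
  have F'_zero: "F' (\<xi>, w, z) = 0 \<longleftrightarrow>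
      lagrangian_jac_xy g G h x y p *v \<xi> + H *v w + transpose J *v z = 0 \<and>
      z \<in> K \<and> jac_x G x y *v \<xi> + J *v w \<in> orthogonal_comp K" for \<xi> w z
  proof -
    have "G' (x, y) (\<xi>, w) = jac_x G x y *v \<xi> + J *v w"
      unfolding J_def jac_x_mult_vec[OF G'] jac_y_mult_vec[OF G'] blinfun.add_right[symmetric] by simp
    moreover have "\<psi>' (x, y, p) (\<xi>, w, z) =
        lagrangian_jac_xy g G h x y p *v \<xi> + H *v w + transpose J *v z"
      unfolding H_def J_def by (rule y_stationarity_derivative[OF g' G' c \<psi>'])
    ultimately show ?thesis
      by (simp add: F'_def zero_prod_def R_def residual_eq_iff del: transpose_matrix_vector)
  qed
  \<comment> \<open>The second-order condition in the sign convention of \<open>F'_zero\<close>,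
    where it describes the kernel for \<xi> = 0.\<close>
  have nondeg: "w = 0 \<and> z = 0" if "z \<in> K" "H *v w + transpose J *v z = 0" "J *v w \<in> orthogonal_comp K" for w z
  proof (rule second_order)
    show "z \<in> critical_cone (conjugate h) p (G (x, y))"
      using that(1) by (simp add: K_def u_def)
    show "- (transpose (jac_y G x y) *v z) = lagrangian_hess_yy g G h x y p *v w"
      using that(2) unfolding H_def J_def by (simp only: eq_neg_iff_add_eq_0[symmetric])
    show "- (jac_y G x y *v w) \<in> orthogonal_comp (critical_cone (conjugate h) p (G (x, y)))"
      using subspace_neg[OF subspace_orthogonal_comp that(3)] by (simp add: K_def u_def J_def)
  qed
  have inj: "v = 0" if "frechet_derivative F (at (x, y, p)) (0, v) = 0" for v
  proof -
    obtain w z where v: "v = (w, z)" by fastforce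
    have "F' (0, w, z) = 0"
      using that frechet_derivative_at[OF dF] v by simp
    then show ?thesis
      using nondeg[of z w] unfolding F'_zero v by (simp add: zero_prod_def del: transpose_matrix_vector)
  qed
  obtain \<sigma> U W where U: "open U" "x \<in> U" and W: "open W" "(y, p) \<in> W" and UW: "U \<times> W \<subseteq> N"
    and \<sigma>_C1: "C1_on U \<sigma>" and \<sigma>_W: "\<And>x'. x' \<in> U \<Longrightarrow> \<sigma> x' \<in> W"
    and \<sigma>_iff: "\<And>x' w. x' \<in> U \<Longrightarrow> w \<in> W \<Longrightarrow> F (x', w) = 0 \<longleftrightarrow> w = \<sigma> x'"
    by (rule implicit_function_C1[OF F_C1 F0 inj \<open>open N\<close> xyN], assumption)
      (rule that; assumption)
  have S: "solution_map g G h x' = {\<sigma> x'}" if x': "x' \<in> U" for x'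
  proof (rule convex_locally_singleton_imp_singleton[OF _ W(1) \<sigma>_W[OF x']])
    show "convex (solution_map g G h x')"
      by (rule convex_solution_map[OF g' G' g_convex G_convex h_proper h_nondecreasing])
    have "w \<in> solution_map g G h x' \<longleftrightarrow> w = \<sigma> x'" if "w \<in> W" for w
      using F_iff[of x' w] \<sigma>_iff[OF x' that] UW x' that by auto
    then show "solution_map g G h x' \<inter> W = {\<sigma> x'}"
      using \<sigma>_W[OF x'] by blast
  qed
  have \<sigma>x: "\<sigma> x = (y, p)" using S[OF U(2)] solution by simp
  have the_S: "the_elem (solution_map g G h x') = \<sigma> x'" if "x' \<in> U" for x'
    using S[OF that] by simp
  have unique: "solution_map g G h x = {(y, p)}"
    using S[OF U(2)] \<sigma>x by simp
  have "\<forall>x'\<in>U. is_singleton (solution_map g G h x')"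
    using S by (simp add: is_singleton_def)
  moreover have "C1_on U (\<lambda>x'. the_elem (solution_map g G h x'))"
    by (rule C1_on_cong[OF U(1) _ \<sigma>_C1]) (simp add: the_S)
  ultimately have smooth: "\<exists>U. open U \<and> x \<in> U \<and> (\<forall>x'\<in>U. is_singleton (solution_map g G h x')) \<and>
      C1_on U (\<lambda>x'. the_elem (solution_map g G h x'))"
    using U by blast
  obtain \<sigma>' where \<sigma>': "(\<sigma> has_derivative \<sigma>') (at x)"
    using \<sigma>_C1 U(2) unfolding C1_on_def by blast
  \<comment> \<open>Implicit differentiation of \<open>F (x', \<sigma> x')\<close>, which vanishes
    identically near x.\<close>
  have F'\<sigma>': "F' (\<xi>, \<sigma>' \<xi>) = 0" for \<xi>
  proof -
    have "((\<lambda>x'. (x', \<sigma> x')) has_derivative (\<lambda>\<xi>. (\<xi>, \<sigma>' \<xi>))) (at x)"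
      by (intro has_derivative_Pair has_derivative_ident \<sigma>')
    moreover have "(F has_derivative F') (at (x, \<sigma> x))"
      using dF \<sigma>x by simp
    ultimately have chain: "((\<lambda>x'. F (x', \<sigma> x')) has_derivative (\<lambda>\<xi>. F' (\<xi>, \<sigma>' \<xi>))) (at x)"
      by (rule has_derivative_compose)
    have "((\<lambda>x'. F (x', \<sigma> x')) has_derivative (\<lambda>\<xi>. 0)) (at x)"
      by (rule has_derivative_transform_within_open[OF has_derivative_const[of 0] U])
        (simp add: \<sigma>_iff \<sigma>_W)
    from has_derivative_unique[OF chain this] show ?thesis
      by (rule fun_cong)
  qed
  have jac: "jacobian (\<lambda>x'. case the_elem (solution_map g G h x') of (y', p') \<Rightarrow> vstack y' p') (at x) *v \<xi> =
      vstack (fst (\<sigma>' \<xi>)) (snd (\<sigma>' \<xi>))" for \<xi>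
  proof (rule jacobian_mult_vec)
    show "((\<lambda>x'. case the_elem (solution_map g G h x') of (y', p') \<Rightarrow> vstack y' p') has_derivative
        (\<lambda>\<xi>. vstack (fst (\<sigma>' \<xi>)) (snd (\<sigma>' \<xi>)))) (at x)"
      by (rule has_derivative_transform_within_open[OF
            bounded_linear.has_derivative[OF bounded_linear_vstack \<sigma>'] U])
        (simp add: the_S case_prod_beta)
  qed
  let ?A = "kkt_matrix g G h x y p"
  let ?M = "vstack (lagrangian_jac_xy g G h x y p) (jac_x G x y)"
  have A: "?A *v vstack w z = vstack (H *v w + transpose J *v z) (J *v w)" for w z
    by (simp add: kkt_matrix_def H_def J_def vstack_mult_vec hstack_mult_vstack del: transpose_matrix_vector)
  have "invertible (transpose B ** ?A ** B) \<and>
      jacobian (\<lambda>x'. case the_elem (solution_map g G h x') of (y', p') \<Rightarrow> vstack y' p') (at x) =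
        - (B ** matrix_inv (transpose B ** ?A ** B) ** transpose B ** ?M)"
    if B: "columns_form_basis B {vstack w z | w z. z \<in> critical_cone (conjugate h) p (G (x, y))}"
    for B :: "real^'k^('m + 's)"
  proof -
    define V where "V = {vstack w z | (w :: real^'m) (z :: real^'s). z \<in> K}"
    have B': "columns_form_basis B V" using B by (simp add: V_def K_def u_def)
    have V_comp: "vstack a b \<in> orthogonal_comp V \<longleftrightarrow> a = 0 \<and> b \<in> orthogonal_comp K" for a b
      unfolding V_def by (rule vstack_in_orthogonal_comp[OF subspace_0[OF K]])
    \<comment> \<open>In block form the second-order condition says that the matrix sends no nonzero
      vector of \<open>V\<close> into the complement of \<open>V\<close>.\<close>
    have V_nondeg: "v = 0" if v: "v \<in> V" "?A *v v \<in> orthogonal_comp V" for v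
    proof -
      obtain w z where wz: "v = vstack w z" "z \<in> K" using v(1) V_def by blast
      then show ?thesis
        using v(2) nondeg[of z w] unfolding wz(1) A V_comp vstack_eq_0_iff by blast
    qed
    note red = reduced_linear_system[OF B' V_nondeg]
    \<comment> \<open>The linearised system places the derivative in \<open>V\<close> and solves the
      block equation up to the complement of \<open>V\<close>, which is the situation of
      \<open>reduced_linear_system\<close>.\<close>
    have "vstack (fst (\<sigma>' \<xi>)) (snd (\<sigma>' \<xi>)) =
        - (B *v (matrix_inv (transpose B ** ?A ** B) *v (transpose B *v (?M *v \<xi>))))" for \<xi>
    proof (rule red(2))
      obtain w z where wz: "\<sigma>' \<xi> = (w, z)" by fastforce
      have *: "lagrangian_jac_xy g G h x y p *v \<xi> + H *v w + transpose J *v z = 0" "z \<in> K"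
          "jac_x G x y *v \<xi> + J *v w \<in> orthogonal_comp K"
        using F'\<sigma>'[of \<xi>] unfolding wz F'_zero by blast+
      show "vstack (fst (\<sigma>' \<xi>)) (snd (\<sigma>' \<xi>)) \<in> V"
        using *(2) by (auto simp: wz V_def)
      show "?A *v vstack (fst (\<sigma>' \<xi>)) (snd (\<sigma>' \<xi>)) + ?M *v \<xi> \<in> orthogonal_comp V"
        unfolding wz fst_conv snd_conv A vstack_mult_vec vstack_add V_comp
        using *(1,3) by (simp add: ac_simps del: transpose_matrix_vector)
    qed
    then show ?thesis
      using red(1)
      by (simp only: matrix_eq jac minus_matrix_mult_vec matrix_vector_mul_assoc matrix_mul_assoc simp_thms)
  qed
  then show ?thesis
    using unique smooth by blast
qed

end
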